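(* Let $\mathcal{K}(x)=e^{-|x|}/2$ and $d>0$. Let $f:\mathbb{R}\to\mathbb{R}$ be smooth and assume there is $a\in(0,1)$ such that $f(0)=f(a)=f(1)=0$, $f<0$ on $(0,a)$, $f>0$ on $(a,1)$, $f'(0)<0$, $f'(1)<0$, $f'(a)>0$ and $\int_0^1 f(u)\,\mathrm{d}u>0$. Let $g(u):=u-\frac{f(u)}{d}$ and assume that there exist $0<\beta<\gamma<1$ such that $g'>0$ on $[0,\beta)\cup(\gamma,1]$, $g'<0$ on $(\beta,\gamma)$ and $g'(\beta)=g'(\gamma)=0$. Let $u_+\in(\gamma,1)$ be such that $f'(u_+)=0$ and $f'(u)<0$ for all $u\in(u_+,1]$, and assume $g(u_+)<0$. Then there exists $\widetilde{\ell}_0>0$ such that for all $\ell\in(0,\widetilde{\ell}_0)$ the solution $u_\ell$ of the Cauchy problem $$\partial_t u = d(-u+\mathcal{K}*u)+f(u),\quad t>0,\ x\in\mathbb{R},\qquad u(0,x)=\mathbf{1}_{[-\ell,\ell]}(x),\quad x\in\mathbb{R},$$ satisfies $$U(x)\le\liminf_{t\to+\infty}u_\ell(t,x)\quad\text{uniformly in }x\in\mathbb{R}\setminus\{\pm\ell\},$$ where $U$ is a discontinuous ground state with discontinuity points precisely at $\pm\ell$.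
   Context: $\mathcal{K}*u$ denotes convolution on $\mathbb{R}$ in the space variable. The Cauchy problem has a unique global solution $u_\ell\in\mathscr{C}^1((0,+\infty),L^1(\mathbb{R})\cap L^\infty(\mathbb{R}))\cap\mathscr{C}^0([0,+\infty),L^1(\mathbb{R})\cap L^\infty(\mathbb{R}))$, which is what "the solution" refers to. A ground state is a bounded, even function $U\in L^2(\mathbb{R})$, possibly discontinuous, with $0=d(-U+\mathcal{K}*U)+f(U)$ on $\mathbb{R}$, $U(\pm\infty)=0$ and $U>0$ on $\mathbb{R}$. The number $u_+$ exists because $f'(\gamma)=d>0$ and $f'(1)<0$. "$U(x)\le\liminf_{t\to+\infty}u_\ell(t,x)$ uniformly in $x\in A$" means: for every $\varepsilon>0$ there is $T>0$ such that $u_\ell(t,x)\ge U(x)-\varepsilon$ for all $t\ge T$ and $x\in A$. *)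

theory Defs
  imports "HOL-Probability.Essential_Supremum"
begin

definition smooth :: "(real \<Rightarrow> real) \<Rightarrow> bool" where
  "smooth f \<longleftrightarrow> (\<forall>n x. ((deriv ^^ n) f) field_differentiable (at x))"

definition convolution :: "(real \<Rightarrow> real) \<Rightarrow> (real \<Rightarrow> real) \<Rightarrow> real \<Rightarrow> real" where
  "convolution K v x = (\<integral>y. K (x - y) * v y \<partial>lborel)"

text \<open>Elements of \<open>L\<^sup>1(\<real>) \<inter> L\<^sup>\<infinity>(\<real>)\<close> are represented by functions
  that are identified when they agree almost everywhere; the norm is the sum of the
  two norms.\<close>

definition norm_L1_Linf :: "(real \<Rightarrow> real) \<Rightarrow> ennreal" where
  "norm_L1_Linf v =
     (\<integral>\<^sup>+x. ennreal \<bar>v x\<bar> \<partial>lborel) + esssup lborel (\<lambda>x. ennreal \<bar>v x\<bar>)"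

definition L1_Linf :: "(real \<Rightarrow> real) set" where
  "L1_Linf = {v. v \<in> borel_measurable lborel \<and> norm_L1_Linf v < \<infinity>}"

definition L1_Linf_continuous_on :: "real set \<Rightarrow> (real \<Rightarrow> real \<Rightarrow> real) \<Rightarrow> bool" where
  "L1_Linf_continuous_on S u \<longleftrightarrow>
     (\<forall>t\<in>S. u t \<in> L1_Linf) \<and>
     (\<forall>t\<in>S. ((\<lambda>s. norm_L1_Linf (\<lambda>x. u s x - u t x)) \<longlongrightarrow> 0) (at t within S))"

definition L1_Linf_has_derivative_at ::
  "(real \<Rightarrow> real \<Rightarrow> real) \<Rightarrow> (real \<Rightarrow> real) \<Rightarrow> real \<Rightarrow> bool" where
  "L1_Linf_has_derivative_at u w t \<longleftrightarrow>
     w \<in> L1_Linf \<and>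
     ((\<lambda>h. norm_L1_Linf (\<lambda>x. (u (t + h) x - u t x) / h - w x)) \<longlongrightarrow> 0) (at 0)"

text \<open>The solution \<open>u\<close>, written \<open>u t x\<close>, lies in
  \<open>C\<^sup>1((0,\<infinity>), L\<^sup>1 \<inter> L\<^sup>\<infinity>) \<inter> C\<^sup>0([0,\<infinity>), L\<^sup>1 \<inter> L\<^sup>\<infinity>)\<close>; its values at negative
  times are irrelevant. The equation and the initial condition are equalities in that
  space, hence almost everywhere in \<open>x\<close>.\<close>

definition cauchy_solution ::
  "(real \<Rightarrow> real) \<Rightarrow> real \<Rightarrow> (real \<Rightarrow> real) \<Rightarrow> (real \<Rightarrow> real) \<Rightarrow> (real \<Rightarrow> real \<Rightarrow> real) \<Rightarrow> bool" where
  "cauchy_solution K d f u0 u \<longleftrightarrow>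
     L1_Linf_continuous_on {0..} u \<and>
     (\<exists>u'. L1_Linf_continuous_on {0<..} u' \<and>
           (\<forall>t>0. L1_Linf_has_derivative_at u (u' t) t) \<and>
           (\<forall>t>0. AE x in lborel. u' t x = d * (- u t x + convolution K (u t) x) + f (u t x))) \<and>
     (AE x in lborel. u 0 x = u0 x)"

definition ground_state ::
  "(real \<Rightarrow> real) \<Rightarrow> real \<Rightarrow> (real \<Rightarrow> real) \<Rightarrow> (real \<Rightarrow> real) \<Rightarrow> bool" where
  "ground_state K d f U \<longleftrightarrow>
     bounded (range U) \<and>
     (\<forall>x. U (- x) = U x) \<and>
     U \<in> borel_measurable lborel \<and> integrable lborel (\<lambda>x. (U x)\<^sup>2) \<and>
     (\<forall>x. 0 = d * (- U x + convolution K U x) + f (U x)) \<and>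
     (U \<longlongrightarrow> 0) at_top \<and> (U \<longlongrightarrow> 0) at_bot \<and>
     (\<forall>x. U x > 0)"

definition le_liminf_uniformly_on ::
  "real set \<Rightarrow> (real \<Rightarrow> real) \<Rightarrow> (real \<Rightarrow> real \<Rightarrow> real) \<Rightarrow> bool" where
  "le_liminf_uniformly_on A U u \<longleftrightarrow>
     (\<forall>\<epsilon>>0. \<exists>T>0. \<forall>t\<ge>T. \<forall>x\<in>A. u t x \<ge> U x - \<epsilon>)"

text \<open>A solution is given at each time only up to null sets, whereas the lower bound is
  claimed at every point of \<open>A\<close>. The values meant are those of the representative
  that is continuous in \<open>x\<close> on \<open>A\<close>; for \<open>A\<close> open there is at most one such
  representative, up to its values outside \<open>A\<close>.\<close>

definition continuous_representative_on ::
  "real set \<Rightarrow> (real \<Rightarrow> real \<Rightarrow> real) \<Rightarrow> (real \<Rightarrow> real \<Rightarrow> real) \<Rightarrow> bool" where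
  "continuous_representative_on A u v \<longleftrightarrow>
     (\<forall>t\<ge>0. (AE x in lborel. v t x = u t x) \<and> continuous_on A (v t))"

end

theory Submission
  imports Defs
begin

text \<open>Since \<open>g(u\<^sub>+) < 0\<close> there is \<open>\<rho> \<in> (u\<^sub>+, 1)\<close> with \<open>g(\<rho>) = 0\<close>, and for a small \<open>\<delta> > 0\<close>
  one has \<open>f' \<le> - m < 0\<close> on \<open>[0, \<delta>] \<union> [\<rho>, 1]\<close>. Consider the set of functions with values in \<open>[\<rho>, 1]\<close> on
  \<open>[- l, l]\<close> and in \<open>[0, \<delta>]\<close> elsewhere; it contains the initial datum. The nonlocal term is nonnegative
  and \<open>d\<rho> \<le> f(\<rho>)\<close>, so the inner lower barrier holds; outside, the nonlocal term is at most \<open>\<delta> + l\<close>, so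
  the upper barrier holds as soon as \<open>f(\<delta>) + d l \<le> 0\<close>. The set is thus invariant under small explicit Euler
  steps, which are monotone and contract the supremum norm by the factor \<open>1 - \<tau> m\<close>. Iterating
  from the least element gives a stationary solution \<open>U\<close> in the set, which is the ground state, and
  letting the step tend to \<open>0\<close> gives \<open>\<bar>u(t, x) - U(x)\<bar> \<le> exp (- m t)\<close>. Continuity in \<open>x\<close> off \<open>\<plusminus>l\<close>
  passes from the Euler iterates to their uniform limit.\<close>

section \<open>Convolution with the Laplace kernel\<close>

definition laplace_kernel :: "real \<Rightarrow> real" where
  "laplace_kernel x = exp (- \<bar>x\<bar>) / 2"

lemma has_bochner_integral_exp_abs:
  assumes "c > (0::real)"
  shows "has_bochner_integral lborel (\<lambda>x::real. exp (- c * \<bar>x\<bar>)) (2 / c)"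
proof (rule has_bochner_integral_nn_integral)
  have half: "(\<integral>\<^sup>+x. ennreal (exp (- c * x)) * indicator {0..} x \<partial>lborel) = ennreal (0 - (- exp (- c * 0) / c))"
  proof (rule nn_integral_FTC_atLeast)
    show "((\<lambda>x. - exp (- c * x) / c) \<longlongrightarrow> 0) at_top"
      by (rule tendsto_eq_intros filterlim_compose[OF exp_at_bot] filterlim_tendsto_neg_mult_at_bot[OF tendsto_const _ filterlim_ident] | use assms in simp)+
    show "\<And>x. 0 \<le> x \<Longrightarrow> DERIV (\<lambda>x. - exp (- c * x) / c) x :> exp (- c * x)"
      using assms by (auto intro!: derivative_eq_intros)
  qed auto
  have "(\<integral>\<^sup>+x. ennreal (exp (- c * \<bar>x\<bar>)) \<partial>lborel) =
    (\<integral>\<^sup>+x. ennreal (exp (- c * x)) * indicator {0..} x + ennreal (exp (- c * (-x))) * indicator {0..} (-x) \<partial>lborel)"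
    \<comment> \<open>Both indicators equal 1 at the origin, so the two integrands agree only off
      the null set containing 0.\<close>
    by (rule nn_integral_cong_AE, rule AE_mp[OF AE_lborel_singleton[of 0]])
       (auto simp: indicator_def)
  also have "\<dots> = (\<integral>\<^sup>+x. ennreal (exp (- c * x)) * indicator {0..} x \<partial>lborel) + 
     (\<integral>\<^sup>+x. ennreal (exp (- c * (-x))) * indicator {0..} (-x) \<partial>lborel)"
    by (rule nn_integral_add) auto
  also have "(\<integral>\<^sup>+x. ennreal (exp (- c * (-x))) * indicator {0..} (-x) \<partial>lborel) =
     (\<integral>\<^sup>+x. ennreal (exp (- c * x)) * indicator {0..} x \<partial>lborel)"
    by (subst (2) nn_integral_real_affine[where c="-1" and t=0]) auto
  also note half
  also have "ennreal (0 - (- exp (- c * 0) / c)) + ennreal (0 - (- exp (- c * 0) / c)) = ennreal (2 / c)"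
    using assms by (simp flip: ennreal_plus)
  finally show "(\<integral>\<^sup>+x. ennreal (exp (- c * \<bar>x\<bar>)) \<partial>lborel) = ennreal (2 / c)" .
qed (use assms in auto)

lemma has_bochner_integral_laplace_kernel:
  "has_bochner_integral lborel (\<lambda>y. laplace_kernel (x - y)) 1"
proof -
  have "has_bochner_integral lborel laplace_kernel 1"
    using has_bochner_integral_divide[OF has_bochner_integral_exp_abs[of 1], of 2]
    by (simp add: laplace_kernel_def[abs_def])
  then show ?thesis
    using lborel_has_bochner_integral_real_affine_iff[of "-1" laplace_kernel 1 x] by simp
qed

lemma laplace_kernel_pos: "laplace_kernel x > 0"
  by (simp add: laplace_kernel_def)

lemma laplace_kernel_measurable [measurable]: "laplace_kernel \<in> borel_measurable borel"
  by (simp add: laplace_kernel_def[abs_def])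

text \<open>Bounds are asked only almost everywhere, here and below, because the slices
  \<open>u t\<close> of a solution are controlled only up to null sets.\<close>

lemma integrable_convolution:
  assumes [measurable]: "v \<in> borel_measurable borel" and "AE y in lborel. \<bar>v y\<bar> \<le> B"
  shows "integrable lborel (\<lambda>y. laplace_kernel (x - y) * v y)"
proof (rule Bochner_Integration.integrable_bound)
  show "integrable lborel (\<lambda>y. laplace_kernel (x - y) * B)"
    using has_bochner_integral_laplace_kernel[of x] by (auto intro: integrable.intros)
  show "AE y in lborel. norm (laplace_kernel (x - y) * v y) \<le> norm (laplace_kernel (x - y) * B)"
    using assms(2) by eventually_elim (auto simp: abs_mult intro!: mult_left_mono)
qed simp

lemma convolution_const: "convolution laplace_kernel (\<lambda>_. c) x = c"
  using has_bochner_integral_laplace_kernel[of x]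
  by (simp add: convolution_def has_bochner_integral_iff)

lemma convolution_mono:
  assumes "v \<in> borel_measurable borel" "w \<in> borel_measurable borel"
    and "AE y in lborel. \<bar>v y\<bar> \<le> B" "AE y in lborel. \<bar>w y\<bar> \<le> C"
    and "AE y in lborel. v y \<le> w y"
  shows "convolution laplace_kernel v x \<le> convolution laplace_kernel w x"
  unfolding convolution_def
  by (rule integral_mono_AE)
     (use assms laplace_kernel_pos in \<open>auto intro!: integrable_convolution mult_left_mono less_imp_le\<close>)

lemma convolution_diff:
  assumes "v \<in> borel_measurable borel" "w \<in> borel_measurable borel"
    and "AE y in lborel. \<bar>v y\<bar> \<le> B" "AE y in lborel. \<bar>w y\<bar> \<le> C"
  shows "convolution laplace_kernel (\<lambda>y. v y - w y) x =
    convolution laplace_kernel v x - convolution laplace_kernel w x"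
  unfolding convolution_def right_diff_distrib
  by (rule Bochner_Integration.integral_diff) (use assms in \<open>auto intro!: integrable_convolution\<close>)

text \<open>The kernel is positive with mass 1, so it reproduces constants; comparing
  \<open>v\<close> with \<open>B\<close> and \<open>- B\<close> is enough.\<close>

lemma convolution_abs_le:
  assumes "v \<in> borel_measurable borel" and B: "AE y in lborel. \<bar>v y\<bar> \<le> B"
  shows "\<bar>convolution laplace_kernel v x\<bar> \<le> B"
proof -
  have "convolution laplace_kernel v x \<le> convolution laplace_kernel (\<lambda>_. B) x"
    by (rule convolution_mono[of _ _ B "\<bar>B\<bar>"]) (use assms in auto)
  moreover have "convolution laplace_kernel (\<lambda>_. - B) x \<le> convolution laplace_kernel v x"
    by (rule convolution_mono[of _ _ "\<bar>B\<bar>" B]) (use assms in auto)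
  ultimately show ?thesis
    by (simp add: convolution_const)
qed

lemma convolution_diff_abs_le:
  assumes [measurable]: "v \<in> borel_measurable borel" "w \<in> borel_measurable borel"
    and "AE y in lborel. \<bar>v y\<bar> \<le> B" "AE y in lborel. \<bar>w y\<bar> \<le> C"
    and "AE y in lborel. \<bar>v y - w y\<bar> \<le> D"
  shows "\<bar>convolution laplace_kernel v x - convolution laplace_kernel w x\<bar> \<le> D"
  unfolding convolution_diff[OF assms(1-4), symmetric]
  by (rule convolution_abs_le) (use assms(5) in auto)

lemma convolution_even:
  assumes "\<And>y. v (- y) = v y"
  shows "convolution laplace_kernel v (- x) = convolution laplace_kernel v x"
proof -
  have "convolution laplace_kernel v (- x) = (\<integral>y. laplace_kernel (- x - (- y)) * v (- y) \<partial>lborel)"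
    unfolding convolution_def
    using lborel_integral_real_affine[of "-1" "\<lambda>y. laplace_kernel (- x - y) * v y" 0] by simp
  also have "\<dots> = convolution laplace_kernel v x"
    unfolding convolution_def assms
    by (intro Bochner_Integration.integral_cong) (auto simp: laplace_kernel_def)
  finally show ?thesis .
qed

text \<open>The continuity is that of the kernel, so \<open>v\<close> may jump. Once
  \<open>\<bar>X n - x\<bar> < 1\<close>, the triangle inequality bounds the kernel centred at
  \<open>X n\<close> by \<open>exp 1\<close> times the one centred at \<open>x\<close>, which is an
  integrable majorant common to all these \<open>n\<close>.\<close>

lemma continuous_convolution:
  assumes [measurable]: "v \<in> borel_measurable borel" and B: "AE y in lborel. \<bar>v y\<bar> \<le> B"
  shows "continuous_on UNIV (convolution laplace_kernel v)"
proof -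
  have "isCont (convolution laplace_kernel v) x" for x
    unfolding isCont_def
  proof -
    show "convolution laplace_kernel v \<midarrow>x\<rightarrow> convolution laplace_kernel v x"
    proof (subst tendsto_at_iff_sequentially, intro allI impI, unfold comp_def)
      fix X :: "nat \<Rightarrow> real"
      assume X: "X \<longlonglongrightarrow> x"
      have ev: "\<forall>\<^sub>F n in sequentially. \<bar>X n - x\<bar> < 1"
        using tendstoD[OF X, of 1] by (simp add: dist_real_def)
      then obtain N where N: "\<And>n. n \<ge> N \<Longrightarrow> \<bar>X n - x\<bar> < 1"
        by (auto simp: eventually_sequentially)
      have "(\<lambda>n. convolution laplace_kernel v (X (n + N))) \<longlonglongrightarrow> convolution laplace_kernel v x"
        unfolding convolution_def
      proof (rule integral_dominated_convergence[where w = "\<lambda>y. exp 1 * (laplace_kernel (x - y) * \<bar>v y\<bar>)"])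
        show "integrable lborel (\<lambda>y. exp 1 * (laplace_kernel (x - y) * \<bar>v y\<bar>))"
          by (intro integrable_mult_right integrable_convolution) (use B in auto)
        have le: "laplace_kernel (X (n + N) - y) \<le> exp 1 * laplace_kernel (x - y)" for n y
          using N[of "n + N"] by (auto simp: laplace_kernel_def simp flip: exp_add)
        show "AE y in lborel. norm (laplace_kernel (X (n + N) - y) * v y)
            \<le> exp 1 * (laplace_kernel (x - y) * \<bar>v y\<bar>)" for n
          using mult_right_mono[OF le abs_ge_zero]
          by (intro AE_I2) (simp only: real_norm_def abs_mult abs_of_pos[OF laplace_kernel_pos] mult.assoc)
        show "AE y in lborel. (\<lambda>n. laplace_kernel (X (n + N) - y) * v y) \<longlonglongrightarrow> laplace_kernel (x - y) * v y"
          unfolding laplace_kernel_def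
          by (intro AE_I2 tendsto_intros LIMSEQ_ignore_initial_segment[OF X]) auto
      qed auto
      then show "(\<lambda>n. convolution laplace_kernel v (X n)) \<longlonglongrightarrow> convolution laplace_kernel v x"
        by (rule LIMSEQ_offset)
    qed
  qed
  then show ?thesis
    by (simp add: continuous_on_eq_continuous_at)
qed

lemma measurable_convolution:
  assumes "v \<in> borel_measurable borel" and "AE y in lborel. \<bar>v y\<bar> \<le> B"
  shows "convolution laplace_kernel v \<in> borel_measurable borel"
  using continuous_convolution[OF assms] by (rule borel_measurable_continuous_onI)

lemma tendsto_convolution:
  assumes [measurable]: "\<And>n. v n \<in> borel_measurable borel" "w \<in> borel_measurable borel"
    and B: "\<And>n y. \<bar>v n y\<bar> \<le> B" and lim: "\<And>y. (\<lambda>n. v n y) \<longlonglongrightarrow> w y"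
  shows "(\<lambda>n. convolution laplace_kernel (v n) x) \<longlonglongrightarrow> convolution laplace_kernel w x"
  unfolding convolution_def
proof (rule integral_dominated_convergence[where w = "\<lambda>y. laplace_kernel (x - y) * B"])
  show "integrable lborel (\<lambda>y. laplace_kernel (x - y) * B)"
    by (rule integrable_convolution) auto
  show "AE y in lborel. norm (laplace_kernel (x - y) * v n y) \<le> laplace_kernel (x - y) * B" for n
    using B[of n] laplace_kernel_pos
    by (auto simp: abs_mult abs_of_pos[OF laplace_kernel_pos] intro!: mult_left_mono less_imp_le)
  show "AE y in lborel. (\<lambda>n. laplace_kernel (x - y) * v n y) \<longlonglongrightarrow> laplace_kernel (x - y) * w y"
    by (intro AE_I2 tendsto_intros lim)
qed auto

text \<open>The kernel never exceeds 1/2 and the interval has length \<open>2 * l\<close>. This is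
  where smallness of \<open>l\<close> enters the argument.\<close>

lemma convolution_indicator_le:
  assumes "l \<ge> 0"
  shows "convolution laplace_kernel (indicator {- l..l}) x \<le> l"
proof -
  have "convolution laplace_kernel (indicator {- l..l}) x \<le> (\<integral>y. indicator {- l..l} y / 2 \<partial>lborel)"
    unfolding convolution_def
  proof (rule integral_mono)
    show "integrable lborel (\<lambda>y. laplace_kernel (x - y) * indicator {- l..l} y)"
      by (rule integrable_convolution[where B = 1]) (auto simp: indicator_def)
    show "integrable lborel (\<lambda>y. indicator {- l..l} y / 2 :: real)"
      by (intro integrable_divide integrable_real_indicator) (auto simp: emeasure_lborel_Icc_eq)
  qed (auto simp: indicator_def laplace_kernel_def)
  also have "\<dots> = l"
    using assms by simp
  finally show ?thesis .
qed

text \<open>By \<open>\<bar>x\<bar> \<le> \<bar>x - y\<bar> + \<bar>y\<bar>\<close> the factor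
  \<open>exp (\<mu> * (l - \<bar>x\<bar>))\<close> comes out of the integral. What remains is
  \<open>exp (- (1 - \<mu>) * \<bar>x - y\<bar>) / 2\<close>, of mass
  \<open>1 / (1 - \<mu>)\<close>.\<close>

lemma convolution_exp_le:
  assumes "\<mu> \<ge> 0" "\<mu> < 1"
  shows "convolution laplace_kernel (\<lambda>y. exp (\<mu> * (l - \<bar>y\<bar>))) x \<le> exp (\<mu> * (l - \<bar>x\<bar>)) / (1 - \<mu>)"
proof -
  have int: "has_bochner_integral lborel
      (\<lambda>y. exp (\<mu> * (l - \<bar>x\<bar>)) * (exp (- (1 - \<mu>) * \<bar>x - y\<bar>) / 2)) (exp (\<mu> * (l - \<bar>x\<bar>)) * (2 / (1 - \<mu>) / 2))"
    using lborel_has_bochner_integral_real_affine_iff[of "-1" "\<lambda>y. exp (- (1 - \<mu>) * \<bar>y\<bar>)" "2 / (1 - \<mu>)" x]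
      has_bochner_integral_exp_abs[of "1 - \<mu>"] assms
    by (intro has_bochner_integral_mult_right has_bochner_integral_divide) auto
  have "convolution laplace_kernel (\<lambda>y. exp (\<mu> * (l - \<bar>y\<bar>))) x \<le>
      (\<integral>y. exp (\<mu> * (l - \<bar>x\<bar>)) * (exp (- (1 - \<mu>) * \<bar>x - y\<bar>) / 2) \<partial>lborel)"
    unfolding convolution_def
  proof (rule integral_mono)
    have "\<bar>exp (\<mu> * (l - \<bar>y\<bar>))\<bar> \<le> exp (\<mu> * l)" for y
      using assms by (simp add: mult_left_mono)
    then show "integrable lborel (\<lambda>y. laplace_kernel (x - y) * exp (\<mu> * (l - \<bar>y\<bar>)))"
      by (intro integrable_convolution) auto
    show "integrable lborel (\<lambda>y. exp (\<mu> * (l - \<bar>x\<bar>)) * (exp (- (1 - \<mu>) * \<bar>x - y\<bar>) / 2))"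
      using int by (rule integrable.intros)
    show "laplace_kernel (x - y) * exp (\<mu> * (l - \<bar>y\<bar>)) \<le>
        exp (\<mu> * (l - \<bar>x\<bar>)) * (exp (- (1 - \<mu>) * \<bar>x - y\<bar>) / 2)" for y
    proof -
      have "\<mu> * \<bar>x\<bar> \<le> \<mu> * (\<bar>x - y\<bar> + \<bar>y\<bar>)"
        using assms by (intro mult_left_mono) auto
      then show ?thesis
        by (simp add: laplace_kernel_def algebra_simps flip: exp_add)
    qed
  qed
  also have "\<dots> = exp (\<mu> * (l - \<bar>x\<bar>)) / (1 - \<mu>)"
    unfolding has_bochner_integral_integral_eq[OF int] using assms by (simp add: field_simps)
  finally show ?thesis .
qed

section \<open>Curves in the intersection of \<open>L\<^sup>1\<close> and \<open>L\<^sup>\<infinity>\<close>\<close>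

lemma L1_Linf_normD:
  assumes [measurable]: "v \<in> borel_measurable borel" and le: "norm_L1_Linf v \<le> ennreal e" and "e \<ge> 0"
  shows "AE x in lborel. \<bar>v x\<bar> \<le> e" "integrable lborel v" "(\<integral>x. \<bar>v x\<bar> \<partial>lborel) \<le> e"
proof -
  have "esssup lborel (\<lambda>x. ennreal \<bar>v x\<bar>) \<le> ennreal e"
    using le unfolding norm_L1_Linf_def by (rule order_trans[rotated]) simp
  then show "AE x in lborel. \<bar>v x\<bar> \<le> e"
    using esssup_AE[of "\<lambda>x. ennreal \<bar>v x\<bar>" lborel] \<open>e \<ge> 0\<close>
    by (auto elim!: eventually_mono dest: order_trans simp flip: ennreal_le_iff)
  have nn: "(\<integral>\<^sup>+x. ennreal \<bar>v x\<bar> \<partial>lborel) \<le> ennreal e"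
    using le unfolding norm_L1_Linf_def by (rule order_trans[rotated]) simp
  show int: "integrable lborel v"
    by (rule integrableI_bounded) (use nn in \<open>auto simp: less_top[symmetric] top_unique\<close>)
  have "ennreal (\<integral>x. \<bar>v x\<bar> \<partial>lborel) \<le> ennreal e"
    using nn by (subst nn_integral_eq_integral[symmetric]) (use int in auto)
  then show "(\<integral>x. \<bar>v x\<bar> \<partial>lborel) \<le> e"
    using \<open>e \<ge> 0\<close> by simp
qed

lemma L1_LinfD:
  assumes "v \<in> L1_Linf"
  shows "v \<in> borel_measurable borel" "integrable lborel v" "\<exists>M. AE x in lborel. \<bar>v x\<bar> \<le> M"
proof -
  show meas: "v \<in> borel_measurable borel"
    using assms by (simp add: L1_Linf_def)
  have "norm_L1_Linf v \<le> ennreal (enn2real (norm_L1_Linf v))"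
    using assms by (simp add: L1_Linf_def)
  from L1_Linf_normD[OF meas this]
  show "integrable lborel v" "\<exists>M. AE x in lborel. \<bar>v x\<bar> \<le> M"
    by auto
qed

section \<open>Integrals over Borel sets as scalar functionals of a curve\<close>

lemma integrable_indicator_mult:
  fixes v :: "real \<Rightarrow> real"
  assumes "A \<in> sets borel" "integrable lborel v"
  shows "integrable lborel (\<lambda>x. indicator A x * v x)"
  using integrable_mult_indicator[of A lborel v] assms by simp

lemma integral_indicator_mult_abs_le:
  assumes A: "A \<in> sets borel" and v: "v \<in> borel_measurable borel" "norm_L1_Linf v \<le> ennreal e" "e \<ge> 0"
  shows "\<bar>\<integral>x. indicator A x * v x \<partial>lborel\<bar> \<le> e"
proof -
  note int = L1_Linf_normD(2)[OF v]
  have "\<bar>\<integral>x. indicator A x * v x \<partial>lborel\<bar> \<le> (\<integral>x. \<bar>indicator A x * v x\<bar> \<partial>lborel)"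
    by (rule integral_abs_bound)
  also have "\<dots> \<le> (\<integral>x. \<bar>v x\<bar> \<partial>lborel)"
    by (rule integral_mono[OF integrable_abs[OF integrable_indicator_mult[OF A int]] integrable_abs[OF int]])
      (auto simp: indicator_def)
  also have "\<dots> \<le> e"
    by (rule L1_Linf_normD(3)[OF v])
  finally show ?thesis .
qed

lemma L1_Linf_continuous_onD:
  assumes "L1_Linf_continuous_on S u" "t \<in> S"
  shows "u t \<in> L1_Linf" "((\<lambda>s. norm_L1_Linf (\<lambda>x. u s x - u t x)) \<longlongrightarrow> 0) (at t within S)"
  using assms by (auto simp: L1_Linf_continuous_on_def)

lemma continuous_on_integral_indicator:
  assumes u: "L1_Linf_continuous_on S u" and A: "A \<in> sets borel"
  shows "continuous_on S (\<lambda>t. \<integral>x. indicator A x * u t x \<partial>lborel)"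
  unfolding continuous_on_def
proof (rule ballI, rule tendstoI)
  fix t and e :: real assume t: "t \<in> S" and "e > 0"
  then have "\<forall>\<^sub>F s in at t within S. norm_L1_Linf (\<lambda>x. u s x - u t x) < ennreal (e / 2)"
    by (intro order_tendstoD[OF L1_Linf_continuous_onD(2)[OF u t]]) auto
  moreover have "\<forall>\<^sub>F s in at t within S. s \<in> S"
    by (simp add: eventually_at_filter)
  ultimately show "\<forall>\<^sub>F s in at t within S. dist (\<integral>x. indicator A x * u s x \<partial>lborel) (\<integral>x. indicator A x * u t x \<partial>lborel) < e"
  proof eventually_elim
    case (elim s)
    note D = L1_LinfD(1,2)[OF L1_Linf_continuous_onD(1)[OF u t]] L1_LinfD(1,2)[OF L1_Linf_continuous_onD(1)[OF u elim(2)]]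
    have "\<bar>\<integral>x. indicator A x * (u s x - u t x) \<partial>lborel\<bar> \<le> e / 2"
      using elim(1) D \<open>e > 0\<close> by (intro integral_indicator_mult_abs_le A) auto
    then show ?case
      using D A \<open>e > 0\<close> by (simp add: right_diff_distrib integrable_indicator_mult dist_real_def)
  qed
qed

lemma has_derivative_integral_indicator:
  assumes u: "L1_Linf_continuous_on {0..} u" and der: "L1_Linf_has_derivative_at u w t" and "t > 0"
    and A: "A \<in> sets borel"
  shows "((\<lambda>t. \<integral>x. indicator A x * u t x \<partial>lborel) has_real_derivative (\<integral>x. indicator A x * w x \<partial>lborel)) (at t)"
  unfolding DERIV_def
proof (rule tendstoI)
  fix e :: real assume "e > 0"
  have w: "w \<in> L1_Linf"
    and lim: "((\<lambda>h. norm_L1_Linf (\<lambda>x. (u (t + h) x - u t x) / h - w x)) \<longlongrightarrow> 0) (at 0)"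
    using der by (auto simp: L1_Linf_has_derivative_at_def)
  have "\<forall>\<^sub>F h in at 0. norm_L1_Linf (\<lambda>x. (u (t + h) x - u t x) / h - w x) < ennreal (e / 2)"
    using \<open>e > 0\<close> by (intro order_tendstoD[OF lim]) auto
  moreover have "\<forall>\<^sub>F h in at 0. h \<in> {- t<..}"
    using \<open>t > 0\<close> by (intro eventually_at_in_open') auto
  ultimately show "\<forall>\<^sub>F h in at 0. dist (((\<integral>x. indicator A x * u (t + h) x \<partial>lborel) - (\<integral>x. indicator A x * u t x \<partial>lborel)) / h)
      (\<integral>x. indicator A x * w x \<partial>lborel) < e"
  proof eventually_elim
    case (elim h)
    have th: "t \<in> {0..}" "t + h \<in> {0..}"
      using \<open>t > 0\<close> elim(2) by auto
    note D = L1_LinfD(1,2)[OF w] L1_LinfD(1,2)[OF L1_Linf_continuous_onD(1)[OF u th(1)]]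
      L1_LinfD(1,2)[OF L1_Linf_continuous_onD(1)[OF u th(2)]]
    note ints = integrable_indicator_mult[OF A D(2)] integrable_indicator_mult[OF A D(4)] integrable_indicator_mult[OF A D(6)]
    have "\<bar>\<integral>x. indicator A x * ((u (t + h) x - u t x) / h - w x) \<partial>lborel\<bar> \<le> e / 2"
      using elim(1) D \<open>e > 0\<close> by (intro integral_indicator_mult_abs_le A) auto
    also have "(\<lambda>x. indicator A x * ((u (t + h) x - u t x) / h - w x)) =
        (\<lambda>x. (indicator A x * u (t + h) x - indicator A x * u t x) / h - indicator A x * w x)"
      by (auto simp: algebra_simps diff_divide_distrib)
    finally show ?case
      using ints \<open>e > 0\<close> by (simp add: dist_real_def)
  qed
qed

text \<open>The mean value theorem is applied to the integrals of \<open>u t\<close> over sets of finite measure,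
  which turns the vector-valued derivative into real ones.\<close>

lemma L1_Linf_mean_value:
  assumes u: "L1_Linf_continuous_on {0..} u"
    and der: "\<And>r. r > 0 \<Longrightarrow> L1_Linf_has_derivative_at u (u' r) r"
    and st: "0 \<le> s" "s < t" and c [measurable]: "c \<in> borel_measurable borel"
    and B: "\<And>r. s < r \<Longrightarrow> r < t \<Longrightarrow> AE x in lborel. \<bar>u' r x - c x\<bar> \<le> B"
  shows "AE x in lborel. \<bar>u t x - u s x - (t - s) * c x\<bar> \<le> B * (t - s)"
proof -
  have t: "s \<in> {0..}" "t \<in> {0..}"
    using st by auto
  note D [measurable] = L1_LinfD(1)[OF L1_Linf_continuous_onD(1)[OF u t(1)]] L1_LinfD(1)[OF L1_Linf_continuous_onD(1)[OF u t(2)]]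
  \<comment> \<open>The sign \<open>\<sigma>\<close> yields the upper and the lower bound by one
    argument.\<close>
  have one_sided: "AE x in lborel. \<sigma> * (u t x - u s x - (t - s) * c x) - B * (t - s) \<le> 0" if \<sigma>: "\<bar>\<sigma>\<bar> = 1" for \<sigma> :: real
  proof -
    define w where "w x = \<sigma> * (u t x - u s x - (t - s) * c x) - B * (t - s)" for x
    have [measurable]: "w \<in> borel_measurable borel"
      unfolding w_def[abs_def] by measurable
    \<comment> \<open>The exceptional set is cut off at \<open>n\<close> to have finite measure;
      constants are then integrable over it.\<close>
    have "AE x in lborel. x \<notin> {x \<in> {- real n..real n}. w x > 0}" for n
    proof -
      define A where "A = {x \<in> {- real n..real n}. w x > 0}"
      have A [measurable]: "A \<in> sets borel"
        unfolding A_def by measurable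
      have "emeasure lborel A \<le> emeasure lborel {- real n..real n}"
        by (intro emeasure_mono) (auto simp: A_def)
      also have "\<dots> < \<infinity>"
        by (simp add: emeasure_lborel_Icc_eq)
      finally have iA: "integrable lborel (indicator A :: real \<Rightarrow> real)"
        by (intro integrable_real_indicator) auto
      define P where "P r = (\<integral>x. indicator A x * u r x \<partial>lborel)" for r
      have P_der: "(P has_real_derivative (\<integral>x. indicator A x * u' r x \<partial>lborel)) (at r)" if "r > 0" for r
        unfolding P_def[abs_def] by (rule has_derivative_integral_indicator[OF u der[OF that] that A])
      have "continuous_on {s..t} P"
        unfolding P_def[abs_def]
        by (rule continuous_on_subset[OF continuous_on_integral_indicator[OF u A]]) (use st in auto)
      moreover have "P differentiable (at r)" if "s < r" "r < t" for r
        using P_der[of r] that st by (auto simp: real_differentiable_def)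
      ultimately obtain q r where r: "s < r" "r < t" "(P has_real_derivative q) (at r)" "P t - P s = (t - s) * q"
        using MVT[OF st(2), of P] by auto
      have q: "q = (\<integral>x. indicator A x * u' r x \<partial>lborel)"
        using DERIV_unique[OF r(3) P_der] r(1) st by auto
      have "u' r \<in> L1_Linf"
        using der[of r] r(1) st by (auto simp: L1_Linf_has_derivative_at_def)
      note u' [measurable] = L1_LinfD(1)[OF this] and iu' = integrable_indicator_mult[OF A L1_LinfD(2)[OF this]]
      have iu: "integrable lborel (\<lambda>x. indicator A x * u s x)" "integrable lborel (\<lambda>x. indicator A x * u t x)"
        by (intro integrable_indicator_mult A L1_LinfD(2) L1_Linf_continuous_onD(1)[OF u] t)+
      \<comment> \<open>\<open>c\<close> is merely measurable. Its integrability over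
        \<open>A\<close> is recovered from that of \<open>u' r\<close> and the boundedness of the
        difference.\<close>
      have "integrable lborel (\<lambda>x. indicator A x * (u' r x - c x))"
      proof (rule Bochner_Integration.integrable_bound)
        show "integrable lborel (\<lambda>x. B * indicator A x)"
          using iA by simp
        show "AE x in lborel. norm (indicator A x * (u' r x - c x)) \<le> norm (B * indicator A x)"
          using B[OF r(1,2)] by eventually_elim (auto simp: indicator_def)
      qed simp
      from Bochner_Integration.integrable_diff[OF iu' this]
      have ic: "integrable lborel (\<lambda>x. indicator A x * c x)"
        by (simp add: algebra_simps)
      have "(\<lambda>x. indicator A x * w x) = (\<lambda>x. \<sigma> * (indicator A x * u t x - indicator A x * u s x
          - (t - s) * (indicator A x * c x)) - B * (t - s) * indicator A x)"
        by (auto simp: w_def algebra_simps)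
      then have iw: "integrable lborel (\<lambda>x. indicator A x * w x)"
        and "(\<integral>x. indicator A x * w x \<partial>lborel) = \<sigma> * (P t - P s - (t - s) * (\<integral>x. indicator A x * c x \<partial>lborel))
          - B * (t - s) * (\<integral>x. indicator A x \<partial>lborel)"
        using iu ic iA by (simp_all add: P_def)
      then have "(\<integral>x. indicator A x * w x \<partial>lborel) = (t - s) * (\<sigma> * ((\<integral>x. indicator A x * u' r x \<partial>lborel)
          - (\<integral>x. indicator A x * c x \<partial>lborel)) - B * (\<integral>x. indicator A x \<partial>lborel))"
        unfolding r(4) q by (simp add: algebra_simps)
      also have "\<sigma> * ((\<integral>x. indicator A x * u' r x \<partial>lborel) - (\<integral>x. indicator A x * c x \<partial>lborel)) - B * (\<integral>x. indicator A x \<partial>lborel)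
        = (\<integral>x. \<sigma> * (indicator A x * u' r x - indicator A x * c x) - B * indicator A x \<partial>lborel)"
        using iu' ic iA by simp
      also have "(t - s) * \<dots> \<le> 0"
      proof (rule mult_nonneg_nonpos)
        have "AE x in lborel. \<sigma> * (indicator A x * u' r x - indicator A x * c x) - B * indicator A x \<le> 0"
          using B[OF r(1,2)] by eventually_elim (use \<sigma> in \<open>auto simp: indicator_def abs_if split: if_splits\<close>)
        then have "(\<integral>x. \<sigma> * (indicator A x * u' r x - indicator A x * c x) - B * indicator A x \<partial>lborel)
            \<le> integral\<^sup>L lborel (\<lambda>x::real. 0)"
          using iu' ic iA by (intro integral_mono_AE) auto
        then show "(\<integral>x. \<sigma> * (indicator A x * u' r x - indicator A x * c x) - B * indicator A x \<partial>lborel) \<le> 0"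
          by simp
      qed (use st in auto)
      finally have le0: "(\<integral>x. indicator A x * w x \<partial>lborel) \<le> 0" .
      \<comment> \<open>\<open>w\<close> is positive on \<open>A\<close> while its integral over
        \<open>A\<close> is nonpositive, which forces \<open>A\<close> to be a null set.\<close>
      have nonneg: "AE x in lborel. 0 \<le> indicator A x * w x"
        by (auto simp: A_def indicator_def)
      then have "(\<integral>x. indicator A x * w x \<partial>lborel) = 0"
        using le0 by (intro antisym integral_nonneg_AE)
      then have "AE x in lborel. indicator A x * w x = 0"
        using integral_nonneg_eq_0_iff_AE[OF iw nonneg] by simp
      then show ?thesis
        by eventually_elim (auto simp: A_def indicator_def)
    qed
    then have "AE x in lborel. \<forall>n. x \<notin> {x \<in> {- real n..real n}. w x > 0}"
      by (simp add: AE_all_countable)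
    then show ?thesis
    proof eventually_elim
      case (elim x)
      obtain n where "\<bar>x\<bar> \<le> real n"
        using real_arch_simple by blast
      then show ?case
        using elim by (auto simp: w_def abs_le_iff minus_le_iff)
    qed
  qed
  have "\<bar>1 :: real\<bar> = 1" "\<bar>- 1 :: real\<bar> = 1"
    by auto
  from one_sided[OF this(1)] one_sided[OF this(2)] show ?thesis
    by eventually_elim (auto simp: abs_le_iff)
qed

text \<open>Continuity bounds the slices near each time, and bisection glues these bounds over
  \<open>[0, T]\<close>. Taking \<open>M \<ge> 1\<close> lets the same \<open>M\<close> bound the
  Euler iterates, whose values lie in \<open>[0, 1]\<close>.\<close>

lemma L1_Linf_continuous_on_bounded:
  assumes u: "L1_Linf_continuous_on {0..} u" and "T \<ge> 0"
  obtains M where "M \<ge> 1" "\<And>t. 0 \<le> t \<Longrightarrow> t \<le> T \<Longrightarrow> AE x in lborel. \<bar>u t x\<bar> \<le> M"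
proof -
  \<comment> \<open>The guard \<open>0 \<le> t\<close> is there because the small intervals around
    time 0 in the bisection may reach negative times, where nothing is known about
    \<open>u\<close>.\<close>
  define Q where "Q a b \<longleftrightarrow> (\<exists>M. \<forall>t. a \<le> t \<longrightarrow> t \<le> b \<longrightarrow> 0 \<le> t \<longrightarrow> (AE x in lborel. \<bar>u t x\<bar> \<le> M))" for a b
  have "Q 0 T"
    using \<open>T \<ge> 0\<close>
  proof (induction rule: Bolzano)
    case (trans a b c)
    then obtain M N where M: "\<And>t. a \<le> t \<Longrightarrow> t \<le> b \<Longrightarrow> 0 \<le> t \<Longrightarrow> (AE x in lborel. \<bar>u t x\<bar> \<le> M)"
      and N: "\<And>t. b \<le> t \<Longrightarrow> t \<le> c \<Longrightarrow> 0 \<le> t \<Longrightarrow> (AE x in lborel. \<bar>u t x\<bar> \<le> N)"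
      unfolding Q_def by blast
    have "AE x in lborel. \<bar>u t x\<bar> \<le> max M N" if t: "a \<le> t" "t \<le> c" "0 \<le> t" for t
    proof (cases "t \<le> b")
      case True
      from M[OF t(1) True t(3)] show ?thesis
        by eventually_elim auto
    next
      case False
      then have "b \<le> t"
        by simp
      from N[OF this t(2,3)] show ?thesis
        by eventually_elim auto
    qed
    then show ?case
      unfolding Q_def by blast
  next
    case (local t)
    then have t: "t \<in> {0..}"
      by auto
    note ut = L1_Linf_continuous_onD[OF u t]
    obtain M where M: "AE x in lborel. \<bar>u t x\<bar> \<le> M"
      using L1_LinfD(3)[OF ut(1)] by blast
    have "\<forall>\<^sub>F s in at t within {0..}. norm_L1_Linf (\<lambda>x. u s x - u t x) < ennreal 1"
      by (intro order_tendstoD[OF ut(2)]) auto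
    then obtain \<epsilon> where \<epsilon>: "\<epsilon> > 0" 
      "\<And>s. 0 \<le> s \<Longrightarrow> s \<noteq> t \<Longrightarrow> \<bar>s - t\<bar> < \<epsilon> \<Longrightarrow> norm_L1_Linf (\<lambda>x. u s x - u t x) < ennreal 1"
      by (auto simp: eventually_at dist_real_def)
    have "AE x in lborel. \<bar>u s x\<bar> \<le> M + 1" if s: "0 \<le> s" "\<bar>s - t\<bar> < \<epsilon>" for s
    proof (cases "s = t")
      case True
      with M show ?thesis
        by (auto elim!: eventually_mono)
    next
      case False
      have us: "u s \<in> L1_Linf"
        using L1_Linf_continuous_onD(1)[OF u, of s] s by auto
      have "AE x in lborel. \<bar>u s x - u t x\<bar> \<le> 1"
        using \<epsilon>(2)[OF s(1) False s(2)] L1_LinfD(1)[OF us] L1_LinfD(1)[OF ut(1)]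
        by (intro L1_Linf_normD(1)) auto
      with M show ?thesis
        by eventually_elim auto
    qed
    then show ?case
      unfolding Q_def using \<epsilon>(1) by (intro exI[of _ \<epsilon>] conjI allI impI exI[of _ "M + 1"]) auto
  qed
  then obtain M where M: "\<And>t. 0 \<le> t \<Longrightarrow> t \<le> T \<Longrightarrow> AE x in lborel. \<bar>u t x\<bar> \<le> M"
    unfolding Q_def by blast
  show thesis
  proof (rule that[of "max 1 M"])
    show "AE x in lborel. \<bar>u t x\<bar> \<le> max 1 M" if "0 \<le> t" "t \<le> T" for t
      using M[OF that] by eventually_elim auto
  qed simp
qed

text \<open>The points of \<open>S\<close> violating the bound form an open null set, hence an empty
  one. This turns almost everywhere estimates between Euler iterates into pointwise ones off
  \<open>\<plusminus>l\<close>.\<close>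

lemma continuous_le_of_AE_le:
  fixes h :: "real \<Rightarrow> real"
  assumes "open S" "continuous_on S h" and AE: "AE x in lborel. h x \<le> c" and "x \<in> S"
  shows "h x \<le> c"
proof (rule ccontr)
  assume "\<not> h x \<le> c"
  define O' where "O' = S \<inter> h -` {c<..}"
  have "open O'" "O' \<noteq> {}"
    using assms(1,2,4) \<open>\<not> h x \<le> c\<close> unfolding O'_def by (auto intro: continuous_open_preimage)
  moreover have "O' \<in> null_sets lborel"
  proof -
    have "AE x in lborel. x \<notin> O'"
      using AE by eventually_elim (auto simp: O'_def)
    then show ?thesis
      using \<open>open O'\<close> by (subst (asm) AE_iff_null_sets[symmetric]) auto
  qed
  then have "negligible O'"
    unfolding negligible_iff_null_sets by (rule null_sets_completionI)
  ultimately show False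
    using open_not_negligible by blast
qed

section \<open>Euler steps and the ground state\<close>

text \<open>The two \<open>f_decr\<close> assumptions are the bound \<open>f' \<le> - m\<close> in
  integrated form. \<open>f_\<rho>\<close> amounts to \<open>g \<rho> \<le> 0\<close>, and
  \<open>f_\<delta>\<close> makes \<open>\<delta>\<close> an upper barrier where the convolution is
  at most \<open>\<delta> + l\<close>. The Lipschitz bound covers every ball, as the solution is not
  known beforehand to stay in \<open>[0, 1]\<close>.\<close>

locale stable_window =
  fixes f :: "real \<Rightarrow> real" and d m \<delta> \<rho> l :: real
  assumes d_pos: "d > 0" and m_pos: "m > 0" and l_pos: "l > 0"
    and \<delta>_pos: "\<delta> > 0" and \<delta>_less: "\<delta> < \<rho>" and \<rho>_less: "\<rho> < 1"
    and f_zeros: "f 0 = 0" "f 1 = 0"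
    and f_decr_low: "\<And>u v. 0 \<le> u \<Longrightarrow> u \<le> v \<Longrightarrow> v \<le> \<delta> \<Longrightarrow> f v - f u \<le> - m * (v - u)"
    and f_decr_high: "\<And>u v. \<rho> \<le> u \<Longrightarrow> u \<le> v \<Longrightarrow> v \<le> 1 \<Longrightarrow> f v - f u \<le> - m * (v - u)"
    and f_lipschitz: "\<And>M. \<exists>L>0. \<forall>u v. \<bar>u\<bar> \<le> M \<longrightarrow> \<bar>v\<bar> \<le> M \<longrightarrow> \<bar>f u - f v\<bar> \<le> L * \<bar>u - v\<bar>"
    and f_\<rho>: "d * \<rho> \<le> f \<rho>"
    and f_\<delta>: "f \<delta> + d * l \<le> 0"
begin

lemma continuous_on_f: "continuous_on A f"
proof -
  have "isCont f x" for x
  proof -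
    obtain L where L: "L > 0" "\<And>u v. \<bar>u\<bar> \<le> \<bar>x\<bar> + 1 \<Longrightarrow> \<bar>v\<bar> \<le> \<bar>x\<bar> + 1 \<Longrightarrow> \<bar>f u - f v\<bar> \<le> L * \<bar>u - v\<bar>"
      using f_lipschitz[of "\<bar>x\<bar> + 1"] by auto
    have "eventually (\<lambda>y. \<bar>y - x\<bar> < 1) (at x)"
      unfolding eventually_at by (rule exI[of _ 1]) (auto simp: dist_real_def)
    then have "eventually (\<lambda>y. norm (f y - f x) \<le> L * \<bar>y - x\<bar>) (at x)"
      by eventually_elim (simp, rule L(2), auto)
    moreover have "((\<lambda>y. L * \<bar>y - x\<bar>) \<longlongrightarrow> 0) (at x)"
      by (rule tendsto_eq_intros | simp)+
    ultimately have "((\<lambda>y. f y - f x) \<longlongrightarrow> 0) (at x)"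
      by (rule Lim_null_comparison)
    then show ?thesis
      by (simp add: isCont_def LIM_zero_iff)
  qed
  then show ?thesis
    by (intro continuous_at_imp_continuous_on) auto
qed

lemma f_measurable [measurable]: "f \<in> borel_measurable borel"
  using continuous_on_f by (rule borel_measurable_continuous_onI)

section \<open>Explicit Euler steps and the invariant window\<close>

definition rhs :: "(real \<Rightarrow> real) \<Rightarrow> real \<Rightarrow> real" where
  "rhs u x = d * (- u x + convolution laplace_kernel u x) + f (u x)"

definition euler_step :: "real \<Rightarrow> (real \<Rightarrow> real) \<Rightarrow> real \<Rightarrow> real" where
  "euler_step \<tau> u x = u x + \<tau> * rhs u x"

text \<open>The gap between \<open>\<delta>\<close> and \<open>\<rho>\<close> is what later produces
  the jumps. The endpoints \<open>\<plusminus>l\<close> belong to the upper band, as they do for the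
  initial datum.\<close>

definition window :: "(real \<Rightarrow> real) set" where
  "window = {u. u \<in> borel_measurable borel \<and>
     (\<forall>x. if \<bar>x\<bar> \<le> l then \<rho> \<le> u x \<and> u x \<le> 1 else 0 \<le> u x \<and> u x \<le> \<delta>)}"

definition small_step :: "real \<Rightarrow> bool" where
  "small_step \<tau> \<longleftrightarrow> 0 \<le> \<tau> \<and> \<tau> * (d + m) \<le> 1 \<and>
     (\<forall>u v. 0 \<le> u \<longrightarrow> u \<le> v \<longrightarrow> v \<le> 1 \<longrightarrow> \<tau> * (f u - f v) \<le> (1 - \<tau> * d) * (v - u))"

lemma small_step_exists: "\<exists>\<tau>\<^sub>0>0. \<forall>\<tau>. 0 \<le> \<tau> \<longrightarrow> \<tau> \<le> \<tau>\<^sub>0 \<longrightarrow> small_step \<tau>"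
proof -
  obtain L where L: "L > 0" "\<And>u v. \<bar>u\<bar> \<le> 1 \<Longrightarrow> \<bar>v\<bar> \<le> 1 \<Longrightarrow> \<bar>f u - f v\<bar> \<le> L * \<bar>u - v\<bar>"
    using f_lipschitz[of 1] by auto
  define \<tau>\<^sub>0 where "\<tau>\<^sub>0 = 1 / (d + m + L)"
  have pos: "d + m + L > 0"
    using d_pos m_pos L(1) by simp
  have "small_step \<tau>" if \<tau>: "0 \<le> \<tau>" "\<tau> \<le> \<tau>\<^sub>0" for \<tau>
  proof -
    have "\<tau> * (d + m + L) \<le> 1"
      using \<tau>(2) pos by (simp add: \<tau>\<^sub>0_def field_simps)
    then have sum: "\<tau> * d + \<tau> * m + \<tau> * L \<le> 1"
      by (simp add: algebra_simps)
    have nonneg: "0 \<le> \<tau> * m" "0 \<le> \<tau> * L"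
      using \<tau> m_pos L(1) by auto
    have "\<tau> * (f u - f v) \<le> (1 - \<tau> * d) * (v - u)" if uv: "0 \<le> u" "u \<le> v" "v \<le> 1" for u v
    proof -
      have "f u - f v \<le> L * (v - u)"
        using L(2)[of u v] uv by auto
      then have "\<tau> * (f u - f v) \<le> \<tau> * (L * (v - u))"
        using \<tau> by (intro mult_left_mono)
      also have "\<dots> = (\<tau> * L) * (v - u)"
        by simp
      also have "\<dots> \<le> (1 - \<tau> * d) * (v - u)"
        using sum nonneg uv by (intro mult_right_mono) auto
      finally show ?thesis .
    qed
    then show ?thesis
      using \<tau> sum nonneg by (auto simp: small_step_def distrib_left)
  qed
  moreover have "\<tau>\<^sub>0 > 0"
    using pos by (simp add: \<tau>\<^sub>0_def)
  ultimately show ?thesis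
    by blast
qed

lemma window_measurable: "u \<in> window \<Longrightarrow> u \<in> borel_measurable borel"
  by (simp add: window_def)

lemma window_inner: "u \<in> window \<Longrightarrow> \<bar>x\<bar> \<le> l \<Longrightarrow> \<rho> \<le> u x \<and> u x \<le> 1"
  by (auto simp: window_def split: if_splits)

lemma window_outer: "u \<in> window \<Longrightarrow> \<not> \<bar>x\<bar> \<le> l \<Longrightarrow> 0 \<le> u x \<and> u x \<le> \<delta>"
  unfolding window_def by (smt (verit) mem_Collect_eq)

lemma window_bounds: "u \<in> window \<Longrightarrow> 0 \<le> u x \<and> u x \<le> 1"
  using window_inner[of u x] window_outer[of u x] \<delta>_pos \<delta>_less \<rho>_less
  by (cases "\<bar>x\<bar> \<le> l") auto

lemma window_AE_bounded: "u \<in> window \<Longrightarrow> AE x in lborel. \<bar>u x\<bar> \<le> 1"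
  using window_bounds[of u] by (auto simp: abs_le_iff intro!: AE_I2 order_trans[OF _ zero_le_one])

lemma rhs_measurable:
  assumes [measurable]: "u \<in> borel_measurable borel" and "AE x in lborel. \<bar>u x\<bar> \<le> B"
  shows "rhs u \<in> borel_measurable borel"
  using measurable_convolution[OF assms] unfolding rhs_def[abs_def] by measurable

text \<open>At a given point two elements of the window lie in the same band, so the range between
  \<open>\<delta>\<close> and \<open>\<rho>\<close>, where \<open>f\<close> may increase, is never
  crossed.\<close>

lemma f_decr_window:
  assumes "u \<in> window" "v \<in> window" "v x \<le> u x"
  shows "f (u x) - f (v x) \<le> - m * (u x - v x)"
  using f_decr_low[of "v x" "u x"] f_decr_high[of "v x" "u x"] window_inner[of u x] window_inner[of v x]
    window_outer[of u x] window_outer[of v x] assms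
  by (cases "\<bar>x\<bar> \<le> l") auto

lemma euler_step_eq:
  "euler_step \<tau> u x - euler_step \<tau> v x = ((u x - v x) - \<tau> * d * (u x - v x) + \<tau> * (f (u x) - f (v x)))
    + \<tau> * d * (convolution laplace_kernel u x - convolution laplace_kernel v x)"
  by (simp add: euler_step_def rhs_def algebra_simps)

lemma reaction_part_nonneg:
  assumes "small_step \<tau>" "0 \<le> z" "z \<le> w" "w \<le> 1"
  shows "0 \<le> (w - z) - \<tau> * d * (w - z) + \<tau> * (f w - f z)"
  using assms unfolding small_step_def by (fastforce simp: algebra_simps)

lemma reaction_part_le:
  assumes "small_step \<tau>" "u \<in> window" "v \<in> window" "v x \<le> u x"
  shows "(u x - v x) - \<tau> * d * (u x - v x) + \<tau> * (f (u x) - f (v x)) \<le> (1 - \<tau> * d - \<tau> * m) * (u x - v x)"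
  using mult_left_mono[OF f_decr_window[OF assms(2-4)], of \<tau>] assms(1)
  by (simp add: small_step_def algebra_simps)

text \<open>A discrete comparison principle: the local part is monotone by the choice of the step,
  the nonlocal part because the kernel is positive.\<close>

lemma euler_step_mono:
  assumes \<tau>: "small_step \<tau>" and u: "u \<in> window" and v: "v \<in> window" and "\<And>x. v x \<le> u x"
  shows "euler_step \<tau> v x \<le> euler_step \<tau> u x"
proof -
  have "convolution laplace_kernel v x \<le> convolution laplace_kernel u x"
    by (rule convolution_mono[of _ _ 1 1]) (use assms window_AE_bounded window_measurable in auto)
  then have "0 \<le> \<tau> * d * (convolution laplace_kernel u x - convolution laplace_kernel v x)"
    using \<tau> d_pos by (auto simp: small_step_def)
  then show ?thesis
    using euler_step_eq[of \<tau> u x v] reaction_part_nonneg[OF \<tau>, of "v x" "u x"] assms(4)[of x]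
      window_bounds[OF u, of x] window_bounds[OF v, of x] by simp
qed

text \<open>The local part shrinks differences by \<open>1 - \<tau> * d - \<tau> * m\<close>, and
  the nonlocal part gives back at most \<open>\<tau> * d\<close>, the kernel having mass 1.\<close>

lemma euler_step_contraction:
  assumes \<tau>: "small_step \<tau>" and u: "u \<in> window" and v: "v \<in> window" and B: "\<And>y. \<bar>u y - v y\<bar> \<le> B"
  shows "\<bar>euler_step \<tau> u x - euler_step \<tau> v x\<bar> \<le> (1 - \<tau> * m) * B"
proof -
  \<comment> \<open>By symmetry the order may be fixed at the single point \<open>x\<close>; the two
    functions need not be ordered elsewhere.\<close>
  have *: "\<bar>euler_step \<tau> u x - euler_step \<tau> v x\<bar> \<le> (1 - \<tau> * m) * B"
    if u: "u \<in> window" and v: "v \<in> window" and B: "\<And>y. \<bar>u y - v y\<bar> \<le> B" and le: "v x \<le> u x" for u v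
  proof -
    have "\<bar>convolution laplace_kernel u x - convolution laplace_kernel v x\<bar> \<le> B"
      by (rule convolution_diff_abs_le[of _ _ 1 1]) (use B u v window_AE_bounded window_measurable in auto)
    then have "\<bar>\<tau> * d * (convolution laplace_kernel u x - convolution laplace_kernel v x)\<bar> \<le> \<tau> * d * B"
      using \<tau> d_pos by (auto simp: small_step_def abs_mult intro!: mult_left_mono)
    moreover have "(1 - \<tau> * d - \<tau> * m) * (u x - v x) \<le> (1 - \<tau> * d - \<tau> * m) * B"
      using B[of x] \<tau> by (intro mult_left_mono) (auto simp: small_step_def algebra_simps)
    moreover have "0 \<le> (1 - \<tau> * d - \<tau> * m) * B"
      using B[of x] \<tau> by (intro mult_nonneg_nonneg) (auto simp: small_step_def algebra_simps)
    ultimately show ?thesis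
      using euler_step_eq[of \<tau> u x v] reaction_part_le[OF \<tau> u v le] reaction_part_nonneg[OF \<tau>, of "v x" "u x"] le
      window_bounds[OF u, of x] window_bounds[OF v, of x]
      by (intro abs_leI) (simp_all add: abs_le_iff algebra_simps)
  qed
  show ?thesis
    using *[OF u v B] *[OF v u] B by (cases "v x \<le> u x") (auto simp: abs_minus_commute)
qed

lemma euler_step_measurable:
  assumes "u \<in> window" shows "euler_step \<tau> u \<in> borel_measurable borel"
  using rhs_measurable[OF window_measurable window_AE_bounded, OF assms assms] window_measurable[OF assms]
  unfolding euler_step_def[abs_def] by measurable

text \<open>Monotonicity of the local part reduces each of the four bounds to its barrier level.
  There \<open>\<rho>\<close> is kept by \<open>f_\<rho>\<close> and a nonnegative convolution, 1 by
  \<open>f 1 = 0\<close> and a convolution at most 1, 0 by \<open>f 0 = 0\<close>, and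
  \<open>\<delta>\<close> by \<open>f_\<delta>\<close> and a convolution at most
  \<open>\<delta> + l\<close>.\<close>

lemma euler_step_window:
  assumes \<tau>: "small_step \<tau>" and u: "u \<in> window"
  shows "euler_step \<tau> u \<in> window"
proof -
  note [measurable] = window_measurable[OF u]
  let ?k = "convolution laplace_kernel u"
  have td: "0 \<le> \<tau> * d" "0 \<le> \<tau>"
    using \<tau> d_pos by (auto simp: small_step_def)
  have k0: "0 \<le> ?k x" for x
    using convolution_mono[of "\<lambda>_. 0" u 0 1 x] window_AE_bounded[OF u] window_bounds[OF u]
    by (simp add: convolution_const)
  have k1: "?k x \<le> 1" for x
    using convolution_abs_le[OF window_measurable[OF u] window_AE_bounded[OF u], of x] by simp
  \<comment> \<open>Subtracting the indicator of \<open>[- l, l]\<close> from \<open>u\<close>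
    leaves a function below \<open>\<delta>\<close>, since \<open>u\<close> is at most 1 inside and
    at most \<open>\<delta>\<close> outside.\<close>
  have k\<delta>: "?k x \<le> \<delta> + l" for x
  proof -
    have "?k x - convolution laplace_kernel (indicator {- l..l}) x =
        convolution laplace_kernel (\<lambda>y. u y - indicator {- l..l} y) x"
      by (rule convolution_diff[symmetric, of _ _ 1 1]) (use window_AE_bounded[OF u] in \<open>auto simp: indicator_def\<close>)
    also have "\<dots> \<le> convolution laplace_kernel (\<lambda>_. \<delta>) x"
    proof (rule convolution_mono[of _ _ 1 \<delta>])
      show "AE y in lborel. u y - indicator {- l..l} y \<le> \<delta>"
        using window_inner[OF u] window_outer[OF u] \<delta>_pos by (intro AE_I2) (force simp: indicator_def abs_le_iff)
      show "AE y in lborel. \<bar>u y - indicator {- l..l} y\<bar> \<le> 1"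
      proof (rule AE_I2)
        show "\<bar>u y - indicator {- l..l} y\<bar> \<le> 1" for y
          using window_bounds[OF u, of y] by (auto simp: indicator_def)
      qed
    qed (use \<delta>_pos in auto)
    finally show ?thesis
      using convolution_indicator_le[of l x] l_pos by (simp add: convolution_const)
  qed
  note kt = mult_left_mono[OF k0 td(1)] mult_left_mono[OF k1 td(1)] mult_left_mono[OF k\<delta> td(1)]
  have eq: "euler_step \<tau> u x = u x - \<tau> * d * u x + \<tau> * f (u x) + \<tau> * d * ?k x" for x
    by (simp add: euler_step_def rhs_def algebra_simps)
  have "\<rho> \<le> euler_step \<tau> u x \<and> euler_step \<tau> u x \<le> 1" if x: "\<bar>x\<bar> \<le> l" for x
  proof
    have "0 \<le> (u x - \<rho>) - \<tau> * d * (u x - \<rho>) + \<tau> * (f (u x) - f \<rho>)"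
      using window_inner[OF u x] \<delta>_pos \<delta>_less by (intro reaction_part_nonneg[OF \<tau>]) auto
    then show "\<rho> \<le> euler_step \<tau> u x"
      using kt(1)[of x] mult_left_mono[OF f_\<rho> td(2)] unfolding eq by (simp add: algebra_simps)
    have "0 \<le> (1 - u x) - \<tau> * d * (1 - u x) + \<tau> * (f 1 - f (u x))"
      using window_bounds[OF u] by (intro reaction_part_nonneg[OF \<tau>]) auto
    then show "euler_step \<tau> u x \<le> 1"
      using kt(2)[of x] f_zeros unfolding eq by (simp add: algebra_simps)
  qed
  moreover have "0 \<le> euler_step \<tau> u x \<and> euler_step \<tau> u x \<le> \<delta>" if x: "\<not> \<bar>x\<bar> \<le> l" for x
  proof
    have "0 \<le> (u x - 0) - \<tau> * d * (u x - 0) + \<tau> * (f (u x) - f 0)"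
      using window_bounds[OF u] by (intro reaction_part_nonneg[OF \<tau>]) auto
    then show "0 \<le> euler_step \<tau> u x"
      using kt(1)[of x] f_zeros unfolding eq by (simp add: algebra_simps)
    have "0 \<le> (\<delta> - u x) - \<tau> * d * (\<delta> - u x) + \<tau> * (f \<delta> - f (u x))"
      using window_outer[OF u x] \<delta>_less \<rho>_less by (intro reaction_part_nonneg[OF \<tau>]) auto
    then show "euler_step \<tau> u x \<le> \<delta>"
      using kt(3)[of x] mult_left_mono[OF f_\<delta> td(2)] unfolding eq by (simp add: algebra_simps)
  qed
  ultimately show ?thesis
    using euler_step_measurable[OF u] by (auto simp: window_def)
qed

text \<open>The rate \<open>\<mu> = m / (d + m)\<close> solves
  \<open>d / (1 - \<mu>) = d + m\<close>: outside the interval the nonlocal gain is then balanced by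
  the linear loss. Inside, the exponential is at least 1 and the window bound suffices.\<close>

lemma euler_step_exp_bound:
  assumes \<tau>: "small_step \<tau>" and u: "u \<in> window" and le: "\<And>y. u y \<le> exp (m / (d + m) * (l - \<bar>y\<bar>))"
  shows "euler_step \<tau> u x \<le> exp (m / (d + m) * (l - \<bar>x\<bar>))"
proof (cases "\<bar>x\<bar> \<le> l")
  case True
  then have "1 \<le> exp (m / (d + m) * (l - \<bar>x\<bar>))"
    using d_pos m_pos by simp
  then show ?thesis
    using window_bounds[OF euler_step_window[OF \<tau> u], of x] by linarith
next
  case False
  let ?E = "\<lambda>y. exp (m / (d + m) * (l - \<bar>y\<bar>))"
  have "convolution laplace_kernel u x \<le> convolution laplace_kernel ?E x"
  proof (rule convolution_mono[of _ _ 1 "exp (m / (d + m) * l)"])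
    show "AE y in lborel. \<bar>?E y\<bar> \<le> exp (m / (d + m) * l)"
      using d_pos m_pos by (auto intro!: AE_I2 divide_right_mono mult_left_mono)
  qed (use u le window_measurable window_AE_bounded in auto)
  also have "\<dots> \<le> ?E x / (1 - m / (d + m))"
    by (rule convolution_exp_le) (use d_pos m_pos in auto)
  also have "\<dots> = (d + m) / d * ?E x"
    using d_pos m_pos by (simp add: field_simps)
  finally have "\<tau> * d * convolution laplace_kernel u x \<le> \<tau> * d * ((d + m) / d * ?E x)"
    using \<tau> d_pos by (intro mult_left_mono) (auto simp: small_step_def)
  also have "\<tau> * d * ((d + m) / d * e) = (\<tau> * d + \<tau> * m) * e" for e
    using d_pos by (simp add: field_simps)
  finally have k: "\<tau> * d * convolution laplace_kernel u x \<le> (\<tau> * d + \<tau> * m) * ?E x" .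
  have "f (u x) \<le> - m * u x"
    using f_decr_low[of 0 "u x"] window_outer[OF u False] f_zeros by simp
  then have "\<tau> * f (u x) \<le> \<tau> * (- m * u x)"
    using \<tau> by (intro mult_left_mono) (auto simp: small_step_def)
  moreover have "(1 - \<tau> * d - \<tau> * m) * u x \<le> (1 - \<tau> * d - \<tau> * m) * ?E x"
    using le[of x] \<tau> by (intro mult_left_mono) (auto simp: small_step_def algebra_simps)
  ultimately show ?thesis
    using k by (simp add: euler_step_def rhs_def algebra_simps)
qed

lemma euler_step_continuous_on:
  assumes "u \<in> window" "continuous_on A u"
  shows "continuous_on A (euler_step \<tau> u)"
  unfolding euler_step_def rhs_def
  using continuous_convolution[OF window_measurable window_AE_bounded, OF assms(1) assms(1)] assms(2)
  by (intro continuous_intros continuous_on_compose2[OF continuous_on_f assms(2)])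
     (auto intro: continuous_on_subset)

lemma euler_step_even:
  assumes "\<And>x. u (- x) = u x"
  shows "euler_step \<tau> u (- x) = euler_step \<tau> u x"
  by (simp add: euler_step_def rhs_def assms convolution_even)

section \<open>Existence of an equilibrium by monotone iteration\<close>

lemma euler_iterate_window:
  "small_step \<tau> \<Longrightarrow> u \<in> window \<Longrightarrow> (euler_step \<tau> ^^ n) u \<in> window"
  by (induction n) (auto intro: euler_step_window)

text \<open>The iterates increase and stay bounded, hence converge pointwise, and dominated
  convergence carries the limit through the convolution. Evenness and the exponential bound hold
  along the iteration and survive the limit.\<close>

lemma window_equilibrium_exists:
  obtains U where "U \<in> window" "\<And>x. rhs U x = 0" "\<And>x. U (- x) = U x"
    "\<And>x. U x \<le> exp (m / (d + m) * (l - \<bar>x\<bar>))"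
proof -
  \<comment> \<open>A strictly positive step is taken: only then does a fixed point of the Euler
    step satisfy \<open>rhs U x = 0\<close>.\<close>
  obtain \<tau> where \<tau>: "\<tau> > 0" "small_step \<tau>"
    using small_step_exists by force
  define s where "s n = (euler_step \<tau> ^^ n) (\<lambda>x. \<rho> * indicator {- l..l} x)" for n
  have s_Suc: "s (Suc n) = euler_step \<tau> (s n)" for n
    by (simp add: s_def)
  have "s 0 \<in> window"
    using \<delta>_pos \<delta>_less \<rho>_less by (auto simp: s_def window_def indicator_def)
  then have s_window: "s n \<in> window" for n
    using euler_iterate_window[OF \<tau>(2)] by (simp add: s_def)
  \<comment> \<open>The first inequality holds because \<open>s 0\<close> is the least element of
    the window and \<open>s 1\<close> belongs to it; monotonicity of the step propagates it.\<close>
  have s_mono: "s n x \<le> s (Suc n) x" for n x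
  proof (induction n arbitrary: x)
    case 0
    show ?case
      using window_inner[OF s_window[of "Suc 0"], of x] window_bounds[OF s_window[of "Suc 0"], of x]
      by (auto simp: s_def indicator_def abs_le_iff)
  next
    case (Suc n)
    then show ?case
      using euler_step_mono[OF \<tau>(2) s_window s_window] s_Suc by metis
  qed
  have "convergent (\<lambda>n. s n x)" for x
  proof (rule Bseq_mono_convergent)
    show "Bseq (\<lambda>n. s n x)"
      by (rule BseqI'[of _ 1]) (use window_bounds[OF s_window] in auto)
    show "\<forall>m n. m \<le> n \<longrightarrow> s m x \<le> s n x"
      using lift_Suc_mono_le[of "\<lambda>n. s n x"] s_mono by auto
  qed
  then obtain U where U: "\<And>x. (\<lambda>n. s n x) \<longlonglongrightarrow> U x"
    unfolding convergent_def by metis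
  have [measurable]: "U \<in> borel_measurable borel"
    by (rule borel_measurable_LIMSEQ_real[OF _ window_measurable[OF s_window]]) (rule U)
  have s_exp: "s n x \<le> exp (m / (d + m) * (l - \<bar>x\<bar>))" for n x
  proof (induction n arbitrary: x)
    case 0
    have "\<rho> \<le> exp (m / (d + m) * (l - \<bar>x\<bar>))" if "\<bar>x\<bar> \<le> l"
    proof -
      have "1 \<le> exp (m / (d + m) * (l - \<bar>x\<bar>))"
        using that d_pos m_pos by simp
      then show ?thesis
        using \<rho>_less by linarith
    qed
    then show ?case
      by (cases "\<bar>x\<bar> \<le> l") (auto simp: s_def indicator_def)
  next
    case (Suc n)
    then show ?case
      unfolding s_Suc by (rule euler_step_exp_bound[OF \<tau>(2) s_window])
  qed
  have s_even: "s n (- x) = s n x" for n x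
  proof (induction n arbitrary: x)
    case 0
    show ?case
      by (auto simp: s_def indicator_def)
  next
    case (Suc n)
    then show ?case
      unfolding s_Suc by (rule euler_step_even)
  qed
  show thesis
  proof (rule that)
    have "\<rho> \<le> U x \<and> U x \<le> 1" if "\<bar>x\<bar> \<le> l" for x
      using window_inner[OF s_window that] LIMSEQ_le_const[OF U] LIMSEQ_le_const2[OF U] by blast
    moreover have "0 \<le> U x \<and> U x \<le> \<delta>" if "\<not> \<bar>x\<bar> \<le> l" for x
      using window_outer[OF s_window that] LIMSEQ_le_const[OF U] LIMSEQ_le_const2[OF U] by blast
    ultimately show "U \<in> window"
      by (simp add: window_def)
    show "U x \<le> exp (m / (d + m) * (l - \<bar>x\<bar>))" for x
      using s_exp LIMSEQ_le_const2[OF U] by blast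
    show "U (- x) = U x" for x
      using LIMSEQ_unique[OF U[of "- x"]] U[of x] s_even by simp
    show "rhs U x = 0" for x
    proof -
      have "(\<lambda>n. euler_step \<tau> (s n) x) \<longlonglongrightarrow> euler_step \<tau> U x"
        unfolding euler_step_def rhs_def
      proof (intro tendsto_intros U)
        show "(\<lambda>n. convolution laplace_kernel (s n) x) \<longlonglongrightarrow> convolution laplace_kernel U x"
          by (rule tendsto_convolution[where B = 1])
             (use U s_window window_measurable window_bounds in auto)
        show "(\<lambda>n. f (s n x)) \<longlonglongrightarrow> f (U x)"
          using continuous_on_tendsto_compose[OF continuous_on_f[of UNIV] U] by simp
      qed
      moreover have "(\<lambda>n. euler_step \<tau> (s n) x) \<longlonglongrightarrow> U x"
        using LIMSEQ_Suc[OF U[of x]] by (simp add: s_Suc)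
      ultimately have "euler_step \<tau> U x = U x"
        by (rule LIMSEQ_unique)
      then show ?thesis
        using \<tau>(1) by (simp add: euler_step_def)
    qed
  qed
qed

section \<open>Positivity, jumps and decay of the equilibrium\<close>

lemma window_convolution_pos:
  assumes u: "u \<in> window"
  shows "convolution laplace_kernel u x > 0"
proof -
  have "0 < 2 * l * (\<rho> * exp (- \<bar>x\<bar> - l) / 2)"
    using l_pos \<delta>_pos \<delta>_less by simp
  also have "\<dots> = (\<integral>y. indicator {- l..l} y * (\<rho> * exp (- \<bar>x\<bar> - l) / 2) \<partial>lborel)"
    using l_pos by simp
  also have "\<dots> \<le> convolution laplace_kernel u x"
    unfolding convolution_def
  proof (rule integral_mono)
    show "integrable lborel (\<lambda>y. indicator {- l..l} y * (\<rho> * exp (- \<bar>x\<bar> - l) / 2))"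
      by (intro integrable_mult_left integrable_real_indicator) (auto simp: emeasure_lborel_Icc_eq)
    show "integrable lborel (\<lambda>y. laplace_kernel (x - y) * u y)"
      using window_measurable window_AE_bounded u by (intro integrable_convolution) auto
    \<comment> \<open>On the interval \<open>\<bar>x - y\<bar> \<le> \<bar>x\<bar> + l\<close> and
      \<open>u y \<ge> \<rho>\<close>; off it the left side vanishes.\<close>
    show "indicator {- l..l} y * (\<rho> * exp (- \<bar>x\<bar> - l) / 2) \<le> laplace_kernel (x - y) * u y" for y
    proof (cases "\<bar>y\<bar> \<le> l")
      case True
      have "exp (- \<bar>x\<bar> - l) / 2 * \<rho> \<le> laplace_kernel (x - y) * u y"
        using True window_inner[OF u True] \<delta>_pos \<delta>_less unfolding laplace_kernel_def
        by (intro mult_mono) auto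
      moreover have "indicator {- l..l} y = (1 :: real)"
        using True by (auto simp: indicator_def)
      ultimately show ?thesis
        by (simp add: mult_ac)
    next
      case False
      then have "indicator {- l..l} y = (0 :: real)"
        by (auto simp: indicator_def)
      then show ?thesis
        using window_bounds[OF u, of y] laplace_kernel_pos[of "x - y"] by simp
    qed
  qed
  finally show ?thesis .
qed

text \<open>Subtracting the equations at \<open>x\<close> and \<open>y\<close>, the reaction
  difference has the favourable sign because both values lie in one band, where \<open>f\<close>
  decreases. On each side of \<open>\<plusminus>l\<close> the equilibrium thus inherits the modulus
  of continuity of its convolution.\<close>

lemma window_equilibrium_modulus:
  assumes U: "U \<in> window" and "rhs U x = 0" "rhs U y = 0" and side: "\<bar>x\<bar> \<le> l \<longleftrightarrow> \<bar>y\<bar> \<le> l"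
  shows "\<bar>U x - U y\<bar> \<le> \<bar>convolution laplace_kernel U x - convolution laplace_kernel U y\<bar>"
proof -
  have *: "\<bar>U x - U y\<bar> \<le> \<bar>convolution laplace_kernel U x - convolution laplace_kernel U y\<bar>"
    if "rhs U x = 0" "rhs U y = 0" and side: "\<bar>x\<bar> \<le> l \<longleftrightarrow> \<bar>y\<bar> \<le> l" and le: "U y \<le> U x" for x y
  proof -
    have "f (U x) - f (U y) \<le> - m * (U x - U y)"
      using f_decr_low[of "U y" "U x"] f_decr_high[of "U y" "U x"] window_inner[OF U, of x]
        window_inner[OF U, of y] window_outer[OF U, of x] window_outer[OF U, of y] side le
      by (cases "\<bar>x\<bar> \<le> l") auto
    also have "\<dots> \<le> 0"
      using m_pos le by simp
    finally have "d * (U x - U y) \<le> d * (convolution laplace_kernel U x - convolution laplace_kernel U y)"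
      using that(1,2) by (simp add: rhs_def algebra_simps)
    then show ?thesis
      using d_pos le by simp
  qed
  show ?thesis
    using *[of x y] *[of y x] assms by (cases "U y \<le> U x") (auto simp: abs_minus_commute)
qed

text \<open>Off \<open>\<plusminus>l\<close> continuity comes from that of the convolution. At
  \<open>\<plusminus>l\<close> the value is at least \<open>\<rho>\<close>, while values approached
  from outside are at most \<open>\<delta>\<close>.\<close>

lemma window_equilibrium_discontinuities:
  assumes U: "U \<in> window" and eq: "\<And>x. rhs U x = 0"
  shows "{x. \<not> isCont U x} = {- l, l}"
proof -
  have "isCont U x" if "x \<notin> {- l, l}" for x
  proof -
    have open_side: "open {y. \<bar>y\<bar> < l}" "open {y. l < \<bar>y\<bar>}"
      by (intro open_Collect_less continuous_intros)+
    have ev: "eventually (\<lambda>y. \<bar>x\<bar> \<le> l \<longleftrightarrow> \<bar>y\<bar> \<le> l) (at x)"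
    proof (cases "\<bar>x\<bar> \<le> l")
      case True
      then have "x \<in> {y. \<bar>y\<bar> < l}"
        using that by (auto simp: abs_if split: if_splits)
      from eventually_at_in_open'[OF open_side(1) this] show ?thesis
        by eventually_elim (use True in auto)
    next
      case False
      then have "x \<in> {y. l < \<bar>y\<bar>}"
        by auto
      from eventually_at_in_open'[OF open_side(2) this] show ?thesis
        by eventually_elim (use False in auto)
    qed
    have "isCont (convolution laplace_kernel U) x"
      using continuous_convolution[OF window_measurable window_AE_bounded, OF U U]
      by (simp add: continuous_on_eq_continuous_at)
    then have "((\<lambda>y. \<bar>convolution laplace_kernel U x - convolution laplace_kernel U y\<bar>) \<longlongrightarrow>
        \<bar>convolution laplace_kernel U x - convolution laplace_kernel U x\<bar>) (at x)"
      unfolding isCont_def by (intro tendsto_intros)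
    moreover have "eventually (\<lambda>y. norm (U y - U x) \<le>
        \<bar>convolution laplace_kernel U x - convolution laplace_kernel U y\<bar>) (at x)"
      using ev by eventually_elim (use window_equilibrium_modulus[OF U eq eq, of x] in \<open>auto simp: abs_minus_commute\<close>)
    ultimately have "((\<lambda>y. U y - U x) \<longlongrightarrow> 0) (at x)"
      using Lim_null_comparison[of "\<lambda>y. U y - U x" _ "at x"] by simp
    then show ?thesis
      by (simp add: isCont_def LIM_zero_iff)
  qed
  moreover have "\<not> isCont U l"
  proof
    assume "isCont U l"
    then have "(U \<longlongrightarrow> U l) (at_right l)"
      by (auto simp: isCont_def filterlim_at_split)
    moreover have "eventually (\<lambda>y. U y \<le> \<delta>) (at_right l)"
      unfolding eventually_at_right_field
      by (rule exI[of _ "l + 1"]) (use window_outer[OF U] l_pos in auto)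
    ultimately have "U l \<le> \<delta>"
      by (intro tendsto_upperbound) auto
    then show False
      using window_inner[OF U, of l] \<delta>_less l_pos by auto
  qed
  moreover have "\<not> isCont U (- l)"
  proof
    assume "isCont U (- l)"
    then have "(U \<longlongrightarrow> U (- l)) (at_left (- l))"
      by (auto simp: isCont_def filterlim_at_split)
    moreover have "eventually (\<lambda>y. U y \<le> \<delta>) (at_left (- l))"
      unfolding eventually_at_left_field
      by (rule exI[of _ "- l - 1"]) (use window_outer[OF U] l_pos in auto)
    ultimately have "U (- l) \<le> \<delta>"
      by (intro tendsto_upperbound) auto
    then show False
      using window_inner[OF U, of "- l"] \<delta>_less l_pos by auto
  qed
  ultimately show ?thesis
    by blast
qed

text \<open>Decay and square integrability follow from the exponential bound, using
  \<open>(U x)\<^sup>2 \<le> U x\<close> as \<open>U\<close> takes values in \<open>[0, 1]\<close>.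
  A zero of \<open>U\<close> would leave only the positive convolution term in the equation.\<close>

lemma window_equilibrium_ground_state:
  assumes U: "U \<in> window" and eq: "\<And>x. rhs U x = 0" and even: "\<And>x. U (- x) = U x"
    and le: "\<And>x. U x \<le> exp (m / (d + m) * (l - \<bar>x\<bar>))"
  shows "ground_state laplace_kernel d f U"
proof -
  let ?\<mu> = "m / (d + m)"
  note [measurable] = window_measurable[OF U]
  have \<mu>: "?\<mu> > 0"
    using d_pos m_pos by simp
  have "integrable lborel (\<lambda>x. exp (?\<mu> * l) * exp (- ?\<mu> * \<bar>x\<bar>))"
    using has_bochner_integral_exp_abs[OF \<mu>] by (intro integrable_mult_right) (rule integrable.intros)
  then have int: "integrable lborel (\<lambda>x. (U x)\<^sup>2)"
  proof (rule Bochner_Integration.integrable_bound)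
    have "(U x)\<^sup>2 \<le> exp (?\<mu> * l) * exp (- ?\<mu> * \<bar>x\<bar>)" for x
    proof -
      have "(U x)\<^sup>2 \<le> U x"
        using window_bounds[OF U, of x] by (auto simp: power2_eq_square intro: mult_left_le)
      also have "\<dots> \<le> exp (?\<mu> * l) * exp (- ?\<mu> * \<bar>x\<bar>)"
        using le[of x] by (simp add: right_diff_distrib flip: exp_add)
      finally show ?thesis .
    qed
    then show "AE x in lborel. norm ((U x)\<^sup>2) \<le> norm (exp (?\<mu> * l) * exp (- ?\<mu> * \<bar>x\<bar>))"
      by simp
  qed simp
  have "filterlim (\<lambda>x::real. (- ?\<mu>) * norm x) at_bot at_infinity"
    by (rule filterlim_tendsto_neg_mult_at_bot[OF tendsto_const _ filterlim_norm_at_top]) (use \<mu> in auto)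
  then have "((\<lambda>x::real. exp (?\<mu> * l) * exp ((- ?\<mu>) * norm x)) \<longlongrightarrow> 0) at_infinity"
    by (intro tendsto_mult_right_zero filterlim_compose[OF exp_at_bot])
  moreover have "eventually (\<lambda>x. norm (U x) \<le> exp (?\<mu> * l) * exp ((- ?\<mu>) * norm x)) at_infinity"
    using window_bounds[OF U] le by (intro always_eventually) (simp add: right_diff_distrib flip: exp_add)
  ultimately have lim: "(U \<longlongrightarrow> 0) at_infinity"
    by (rule Lim_null_comparison[rotated])
  note tendsto_mono[OF at_top_le_at_infinity lim] tendsto_mono[OF at_bot_le_at_infinity lim]
  moreover have "U x > 0" for x
    using window_bounds[OF U, of x] eq[of x] window_convolution_pos[OF U, of x] d_pos f_zeros
    by (cases "U x = 0") (auto simp: rhs_def)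
  moreover have "bounded (range U)"
    using window_bounds[OF U] by (auto intro!: boundedI[of _ 1])
  ultimately show ?thesis
    using int even eq unfolding ground_state_def rhs_def by simp
qed

subsection \<open>Convergence of the Cauchy solution\<close>

lemma rhs_zero: "rhs (\<lambda>_. 0) x = 0"
  using f_zeros by (simp add: rhs_def convolution_const)

lemma rhs_lipschitz:
  obtains \<Lambda> where "\<Lambda> > 0" "\<And>v w :: real \<Rightarrow> real. \<And>e. v \<in> borel_measurable borel \<Longrightarrow> w \<in> borel_measurable borel \<Longrightarrow>
    (AE x in lborel. \<bar>v x\<bar> \<le> M) \<Longrightarrow> (AE x in lborel. \<bar>w x\<bar> \<le> M) \<Longrightarrow>
    (AE x in lborel. \<bar>v x - w x\<bar> \<le> e) \<Longrightarrow> AE x in lborel. \<bar>rhs v x - rhs w x\<bar> \<le> \<Lambda> * e"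
proof -
  obtain L where L: "L > 0" "\<And>u v. \<bar>u\<bar> \<le> M \<Longrightarrow> \<bar>v\<bar> \<le> M \<Longrightarrow> \<bar>f u - f v\<bar> \<le> L * \<bar>u - v\<bar>"
    using f_lipschitz[of M] by auto
  show thesis
  \<comment> \<open>One \<open>d\<close> comes from the term \<open>- u\<close>, one from the
    convolution, and \<open>L\<close> is the Lipschitz constant of \<open>f\<close> on the ball of
    radius \<open>M\<close>.\<close>
  proof (rule that[of "2 * d + L"])
    fix v w :: "real \<Rightarrow> real" and e
    assume vw: "v \<in> borel_measurable borel" "w \<in> borel_measurable borel"
      "AE x in lborel. \<bar>v x\<bar> \<le> M" "AE x in lborel. \<bar>w x\<bar> \<le> M"
      and e: "AE x in lborel. \<bar>v x - w x\<bar> \<le> e"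
    from vw(3,4) e show "AE x in lborel. \<bar>rhs v x - rhs w x\<bar> \<le> (2 * d + L) * e"
    proof eventually_elim
      case (elim x)
      let ?k = "convolution laplace_kernel v x - convolution laplace_kernel w x"
      have "\<bar>?k - (v x - w x)\<bar> \<le> 2 * e"
        using convolution_diff_abs_le[OF vw e, of x] elim(3) by linarith
      then have "\<bar>d * (?k - (v x - w x))\<bar> \<le> d * (2 * e)"
        using d_pos by (simp add: abs_mult)
      moreover have "\<bar>f (v x) - f (w x)\<bar> \<le> L * e"
        using L(2)[OF elim(1,2)] mult_left_mono[OF elim(3), of L] L(1) by linarith
      ultimately have "\<bar>d * (?k - (v x - w x)) + (f (v x) - f (w x))\<bar> \<le> d * (2 * e) + L * e"
        by linarith
      then show ?case
        by (simp add: rhs_def algebra_simps)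
    qed
  qed (use d_pos L(1) in simp)
qed

lemma initial_window: "indicator {- l..l} \<in> window"
  using \<delta>_pos \<delta>_less \<rho>_less by (auto simp: window_def indicator_def)

text \<open>Consistency and stability: each of the \<open>k\<close> steps commits an error of order
  \<open>(t / k)\<^sup>2\<close>, and the accumulated amplification is at most
  \<open>exp (t * \<Lambda>)\<close>. As the solution is not known to lie in the window, stability
  rests on the Lipschitz constant \<open>\<Lambda>\<close> and not on the contraction.
  \<open>C\<close> may depend on \<open>t\<close>, since only \<open>k\<close> tends to infinity
  afterwards.\<close>

lemma euler_error:
  assumes u: "cauchy_solution laplace_kernel d f (indicator {- l..l}) u" and "t \<ge> 0"
  obtains C where "\<And>k. k > 0 \<Longrightarrow> small_step (t / real k) \<Longrightarrow>
    AE x in lborel. \<bar>u t x - (euler_step (t / real k) ^^ k) (indicator {- l..l}) x\<bar> \<le> C / real k"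
proof -
  obtain u' where cont: "L1_Linf_continuous_on {0..} u"
    and der: "\<And>r. r > 0 \<Longrightarrow> L1_Linf_has_derivative_at u (u' r) r"
    and eq: "\<And>r. r > 0 \<Longrightarrow> AE x in lborel. u' r x = rhs (u r) x"
    and init: "AE x in lborel. u 0 x = indicator {- l..l} x"
    using u by (auto simp: cauchy_solution_def rhs_def)
  obtain M where M: "M \<ge> 1" "\<And>s. 0 \<le> s \<Longrightarrow> s \<le> t \<Longrightarrow> AE x in lborel. \<bar>u s x\<bar> \<le> M"
    using L1_Linf_continuous_on_bounded[OF cont \<open>t \<ge> 0\<close>] by blast
  obtain \<Lambda> where \<Lambda>: "\<Lambda> > 0" "\<And>v w :: real \<Rightarrow> real. \<And>e. v \<in> borel_measurable borel \<Longrightarrow> w \<in> borel_measurable borel \<Longrightarrow>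
    (AE x in lborel. \<bar>v x\<bar> \<le> M) \<Longrightarrow> (AE x in lborel. \<bar>w x\<bar> \<le> M) \<Longrightarrow>
    (AE x in lborel. \<bar>v x - w x\<bar> \<le> e) \<Longrightarrow> AE x in lborel. \<bar>rhs v x - rhs w x\<bar> \<le> \<Lambda> * e"
    using rhs_lipschitz[of M] by blast
  have meas: "u s \<in> borel_measurable borel" if "0 \<le> s" for s
    using L1_LinfD(1)[OF L1_Linf_continuous_onD(1)[OF cont]] that by auto
  \<comment> \<open>Comparison with the zero function, where \<open>rhs\<close> vanishes, bounds the
    right-hand side along the solution.\<close>
  have rhs_bound: "AE x in lborel. \<bar>rhs (u s) x\<bar> \<le> \<Lambda> * M" if "0 \<le> s" "s \<le> t" for s
    using \<Lambda>(2)[of "u s" "\<lambda>_. 0" M] meas[OF that(1)] M(1) M(2)[OF that] by (simp add: rhs_zero)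
  have lip: "AE x in lborel. \<bar>u r x - u s x\<bar> \<le> \<Lambda> * M * (r - s)" if "0 \<le> s" "s < r" "r \<le> t" for s r
  proof -
    have "AE x in lborel. \<bar>u' q x - 0\<bar> \<le> \<Lambda> * M" if "s < q" "q < r" for q
    proof -
      have q: "0 < q" "0 \<le> q" "q \<le> t"
        using that \<open>0 \<le> s\<close> \<open>r \<le> t\<close> by auto
      from eq[OF q(1)] rhs_bound[OF q(2,3)] show ?thesis
        by eventually_elim simp
    qed
    from L1_Linf_mean_value[OF cont der that(1,2) _ this] show ?thesis
      by simp
  qed
  have one_step: "AE x in lborel. \<bar>u (s + \<tau>) x - u s x - \<tau> * rhs (u s) x\<bar> \<le> \<Lambda>\<^sup>2 * M * \<tau>\<^sup>2"
    if s: "0 \<le> s" "0 < \<tau>" "s + \<tau> \<le> t" for s \<tau>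
  proof -
    have "AE x in lborel. \<bar>u' r x - rhs (u s) x\<bar> \<le> \<Lambda>\<^sup>2 * M * \<tau>" if r: "s < r" "r < s + \<tau>" for r
    proof -
      have r': "0 \<le> r" "0 < r" "r \<le> t" "s \<le> t"
        using r s by auto
      have "AE x in lborel. \<bar>u r x - u s x\<bar> \<le> \<Lambda> * M * (r - s)"
        by (rule lip) (use r r' s in auto)
      then have "AE x in lborel. \<bar>rhs (u r) x - rhs (u s) x\<bar> \<le> \<Lambda> * (\<Lambda> * M * (r - s))"
        by (intro \<Lambda>(2) meas M(2) r' s)
      with eq[OF r'(2)] show ?thesis
      proof eventually_elim
        case (elim x)
        have "\<Lambda> * (\<Lambda> * M * (r - s)) \<le> \<Lambda> * (\<Lambda> * M * \<tau>)"
          using r \<Lambda>(1) M(1) by (intro mult_left_mono) auto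
        then show ?case
          using elim by (simp add: power2_eq_square mult.assoc)
      qed
    qed
    moreover have "rhs (u s) \<in> borel_measurable borel"
      using s by (intro rhs_measurable[OF meas M(2)]) auto
    ultimately have "AE x in lborel. \<bar>u (s + \<tau>) x - u s x - (s + \<tau> - s) * rhs (u s) x\<bar> \<le> \<Lambda>\<^sup>2 * M * \<tau> * (s + \<tau> - s)"
      using s by (intro L1_Linf_mean_value[OF cont der]) auto
    then show ?thesis
      by (simp add: power2_eq_square mult.assoc)
  qed
  show thesis
  proof (rule that)
    fix k :: nat assume k: "k > 0" and small: "small_step (t / real k)"
    define \<tau> where "\<tau> = t / real k"
    define v where "v n = (euler_step \<tau> ^^ n) (indicator {- l..l})" for n
    have \<tau>: "\<tau> \<ge> 0" "real k * \<tau> = t" "small_step \<tau>"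
      using \<open>t \<ge> 0\<close> k small by (auto simp: \<tau>_def)
    have v_window: "v n \<in> window" for n
      unfolding v_def by (rule euler_iterate_window[OF \<tau>(3) initial_window])
    have v_M: "AE x in lborel. \<bar>v n x\<bar> \<le> M" for n
      using window_AE_bounded[OF v_window[of n]] M(1) by (auto elim!: eventually_mono)
    have err: "AE x in lborel. \<bar>u (real n * \<tau>) x - v n x\<bar> \<le> real n * (\<Lambda>\<^sup>2 * M * \<tau>\<^sup>2) * (1 + \<tau> * \<Lambda>) ^ n"
      if "n \<le> k" for n
      using that
    proof (induction n)
      case 0
      show ?case
        using init by eventually_elim (simp add: v_def)
    next
      case (Suc n)
      define D where "D = \<Lambda>\<^sup>2 * M * \<tau>\<^sup>2"
      define e where "e = real n * D * (1 + \<tau> * \<Lambda>) ^ n"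
      have n\<tau>: "0 \<le> real n * \<tau>" "real n * \<tau> \<le> t" "real n * \<tau> + \<tau> \<le> t"
      proof -
        have "real (Suc n) * \<tau> \<le> real k * \<tau>"
          using Suc.prems \<tau>(1) by (intro mult_right_mono) auto
        then show "real n * \<tau> + \<tau> \<le> t"
          unfolding \<tau>(2) by (simp add: algebra_simps)
        then show "real n * \<tau> \<le> t" "0 \<le> real n * \<tau>"
          using \<tau>(1) by auto
      qed
      have IH: "AE x in lborel. \<bar>u (real n * \<tau>) x - v n x\<bar> \<le> e"
        using Suc by (simp add: e_def D_def)
      have R: "AE x in lborel. \<bar>rhs (u (real n * \<tau>)) x - rhs (v n) x\<bar> \<le> \<Lambda> * e"
        by (intro \<Lambda>(2) meas M(2) n\<tau> window_measurable v_window v_M IH)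
      have S: "AE x in lborel. \<bar>u (real n * \<tau> + \<tau>) x - u (real n * \<tau>) x - \<tau> * rhs (u (real n * \<tau>)) x\<bar> \<le> D"
      \<comment> \<open>For \<open>t = 0\<close> the step has length zero, which the mean value
        estimate excludes; both sides are then 0.\<close>
      proof (cases "\<tau> = 0")
        case False
        then show ?thesis
          unfolding D_def using \<tau>(1) by (intro one_step n\<tau>) auto
      qed (simp add: D_def)
      have D0: "0 \<le> D"
        using M(1) by (simp add: D_def)
      have step: "(1 + \<tau> * \<Lambda>) * e + D \<le> real (Suc n) * D * (1 + \<tau> * \<Lambda>) ^ Suc n"
      proof -
        have "1 \<le> (1 + \<tau> * \<Lambda>) ^ Suc n"
          using \<tau>(1) \<Lambda>(1) by (intro one_le_power) auto
        from mult_left_mono[OF this D0] show ?thesis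
          by (simp add: e_def algebra_simps)
      qed
      from IH R S show ?case
      proof eventually_elim
        case (elim x)
        have "u (real (Suc n) * \<tau>) x - v (Suc n) x =
          (u (real n * \<tau> + \<tau>) x - u (real n * \<tau>) x - \<tau> * rhs (u (real n * \<tau>)) x) + (u (real n * \<tau>) x - v n x)
            + \<tau> * (rhs (u (real n * \<tau>)) x - rhs (v n) x)"
          by (simp add: v_def euler_step_def algebra_simps)
        moreover have "\<bar>\<tau> * (rhs (u (real n * \<tau>)) x - rhs (v n) x)\<bar> \<le> \<tau> * (\<Lambda> * e)"
          using elim(2) \<tau>(1) by (simp add: abs_mult mult_left_mono)
        ultimately have "\<bar>u (real (Suc n) * \<tau>) x - v (Suc n) x\<bar> \<le> D + e + \<tau> * (\<Lambda> * e)"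
          using elim(1,3) by linarith
        also have "\<dots> = (1 + \<tau> * \<Lambda>) * e + D"
          by (simp add: algebra_simps)
        also note step
        finally show ?case
          by (simp add: D_def)
      qed
    qed
    have "real k * (\<Lambda>\<^sup>2 * M * \<tau>\<^sup>2) * (1 + \<tau> * \<Lambda>) ^ k \<le> \<Lambda>\<^sup>2 * M * t\<^sup>2 * exp (t * \<Lambda>) / real k"
    proof -
      have "(1 + \<tau> * \<Lambda>) ^ k \<le> exp (\<tau> * \<Lambda>) ^ k"
        using \<tau>(1) \<Lambda>(1) by (intro power_mono exp_ge_add_one_self) auto
      also have "\<dots> = exp (t * \<Lambda>)"
        by (simp flip: exp_of_nat_mult mult.assoc add: \<tau>(2))
      finally have "real k * (\<Lambda>\<^sup>2 * M * \<tau>\<^sup>2) * (1 + \<tau> * \<Lambda>) ^ k \<le> real k * (\<Lambda>\<^sup>2 * M * \<tau>\<^sup>2) * exp (t * \<Lambda>)"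
        using M(1) by (intro mult_left_mono) auto
      also have "\<dots> = \<Lambda>\<^sup>2 * M * t\<^sup>2 * exp (t * \<Lambda>) / real k"
        using k by (simp add: \<tau>_def power2_eq_square field_simps)
      finally show ?thesis .
    qed
    with err[of k] show "AE x in lborel. \<bar>u t x - (euler_step (t / real k) ^^ k) (indicator {- l..l}) x\<bar>
        \<le> \<Lambda>\<^sup>2 * M * t\<^sup>2 * exp (t * \<Lambda>) / real k"
      by (auto simp: \<tau>(2) v_def \<tau>_def[symmetric] elim!: eventually_mono)
  qed
qed

text \<open>\<open>U\<close> is a fixed point of the Euler step for every step size, so the
  contraction applies \<open>n\<close> times. The initial distance is at most 1, both functions
  having values in \<open>[0, 1]\<close>.\<close>

lemma euler_iterate_near_equilibrium:
  assumes \<tau>: "small_step \<tau>" and U: "U \<in> window" "\<And>x. rhs U x = 0" and u: "u \<in> window"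
  shows "\<bar>(euler_step \<tau> ^^ n) u x - U x\<bar> \<le> (1 - \<tau> * m) ^ n"
proof (induction n arbitrary: x)
  case 0
  then show ?case
    using window_bounds[OF U(1), of x] window_bounds[OF u, of x] by auto
next
  case (Suc n)
  have "U = euler_step \<tau> U"
    using U(2) by (auto simp: euler_step_def)
  then show ?case
    using euler_step_contraction[OF \<tau> euler_iterate_window[OF \<tau> u] U(1) Suc.IH, of x] by simp
qed

lemma euler_iterate_continuous_on:
  assumes "small_step \<tau>" "u \<in> window" "continuous_on A u"
  shows "continuous_on A ((euler_step \<tau> ^^ n) u)"
  using assms by (induction n) (auto intro: euler_step_continuous_on euler_iterate_window)

lemma continuous_on_initial: "continuous_on (- {- l, l}) (indicator {- l..l} :: real \<Rightarrow> real)"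
  by (intro continuous_at_imp_continuous_on ballI)
    (auto simp: isCont_indicator frontier_def interior_atLeastAtMost_real)

text \<open>At fixed \<open>t\<close>, the iterates with \<open>k\<close> steps of length
  \<open>t / k\<close> converge uniformly off \<open>\<plusminus>l\<close>. The limit is continuous
  there, agrees with \<open>u t\<close> almost everywhere, and inherits the bound from
  \<open>(1 - t * m / k) ^ k \<le> exp (- m * t)\<close>.\<close>

lemma euler_limit:
  assumes u: "cauchy_solution laplace_kernel d f (indicator {- l..l}) u" and t: "t \<ge> 0"
    and U: "U \<in> window" "\<And>x. rhs U x = 0"
  obtains v where "AE x in lborel. v x = u t x" "continuous_on (- {- l, l}) v"
    "\<And>x. x \<in> - {- l, l} \<Longrightarrow> \<bar>v x - U x\<bar> \<le> exp (- m * t)"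
proof -
  define S where "S = - {- l, l}"
  have "open S"
    by (simp add: S_def open_Compl)
  define w where "w k = (euler_step (t / real k) ^^ k) (indicator {- l..l})" for k
  obtain C where C: "\<And>k. k > 0 \<Longrightarrow> small_step (t / real k) \<Longrightarrow> AE x in lborel. \<bar>u t x - w k x\<bar> \<le> C / real k"
    using euler_error[OF u t] unfolding w_def by blast
  obtain \<tau>\<^sub>0 where \<tau>\<^sub>0: "\<tau>\<^sub>0 > 0" "\<And>\<tau>. 0 \<le> \<tau> \<Longrightarrow> \<tau> \<le> \<tau>\<^sub>0 \<Longrightarrow> small_step \<tau>"
    using small_step_exists by blast
  \<comment> \<open>From \<open>N\<close> on, the step \<open>t / k\<close> is below
    \<open>\<tau>\<^sub>0\<close>; the maximum with 1 keeps \<open>N\<close> positive when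
    \<open>t = 0\<close>.\<close>
  obtain N where N: "t / \<tau>\<^sub>0 \<le> real N" "N > 0"
    using real_arch_simple[of "max 1 (t / \<tau>\<^sub>0)"] by force
  have small: "small_step (t / real k)" if "N \<le> k" for k
  proof (rule \<tau>\<^sub>0(2))
    have "t / \<tau>\<^sub>0 \<le> real k" "k > 0"
      using N that by auto
    then show "t / real k \<le> \<tau>\<^sub>0"
      using \<tau>\<^sub>0(1) by (simp add: field_simps)
  qed (use t in simp)
  have err: "AE x in lborel. \<bar>u t x - w k x\<bar> \<le> C / real k" if "N \<le> k" for k
    using C[OF _ small[OF that]] that N by simp
  have w_cont: "continuous_on S (w k)" if "N \<le> k" for k
    unfolding w_def S_def
    by (intro euler_iterate_continuous_on small that initial_window continuous_on_initial)
  \<comment> \<open>The triangle inequality through \<open>u t\<close> gives the bound almost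
    everywhere; continuity of both iterates on \<open>S\<close> extends it to all of
    \<open>S\<close>.\<close>
  have diff: "\<bar>w j x - w k x\<bar> \<le> C / real j + C / real k" if jk: "N \<le> j" "N \<le> k" and "x \<in> S" for j k x
  proof (rule continuous_le_of_AE_le[OF \<open>open S\<close>, of "\<lambda>x. \<bar>w j x - w k x\<bar>"])
    show "continuous_on S (\<lambda>x. \<bar>w j x - w k x\<bar>)"
      by (intro continuous_intros w_cont jk)
    show "AE x in lborel. \<bar>w j x - w k x\<bar> \<le> C / real j + C / real k"
      using err[OF jk(1)] err[OF jk(2)] by eventually_elim linarith
  qed fact
  have "uniformly_Cauchy_on S w"
    unfolding uniformly_Cauchy_on_def dist_real_def
  proof (intro allI impI)
    fix e :: real assume "e > 0"
    obtain K where K: "real K > 2 * C / e" "K > 0"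
      using reals_Archimedean2[of "max 1 (2 * C / e)"] by force
    have "C / real k < e / 2" if "k \<ge> K" for k
    proof -
      have "2 * C / e < real k" "real k > 0"
        using K that by auto
      then show ?thesis
        using \<open>e > 0\<close> by (simp add: field_simps)
    qed
    then have "\<bar>w j x - w k x\<bar> < e" if "j \<ge> max N K" "k \<ge> max N K" "x \<in> S" for j k x
      using diff[of j k x] that by (smt (verit) field_sum_of_halves max.bounded_iff)
    then show "\<exists>M. \<forall>x\<in>S. \<forall>m\<ge>M. \<forall>n\<ge>M. \<bar>w m x - w n x\<bar> < e"
      by blast
  qed
  then obtain v where v: "uniform_limit S w v sequentially"
    using uniformly_convergent_eq_Cauchy[of S w] by (auto simp: uniformly_convergent_on_def)
  have lim: "(\<lambda>k. w k x) \<longlonglongrightarrow> v x" if "x \<in> S" for x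
    using tendsto_uniform_limitI[OF v that] .
  show thesis
  proof (rule that[of v])
    have "continuous_on S v"
      by (rule uniform_limit_theorem[OF _ v])
         (auto intro!: eventually_mono[OF eventually_ge_at_top[of N]] w_cont)
    then show "continuous_on (- {- l, l}) v"
      by (simp add: S_def)
    have "AE x in lborel. \<forall>k. N \<le> k \<longrightarrow> \<bar>u t x - w k x\<bar> \<le> C / real k"
      unfolding AE_all_countable using err by auto
    moreover have "AE x in lborel. x \<in> S"
      using AE_lborel_singleton[of l] AE_lborel_singleton[of "- l"] by eventually_elim (auto simp: S_def)
    ultimately show "AE x in lborel. v x = u t x"
    proof eventually_elim
      case (elim x)
      have "(\<lambda>k. u t x - w k x) \<longlonglongrightarrow> 0"
      proof (rule Lim_null_comparison)
        show "eventually (\<lambda>k. norm (u t x - w k x) \<le> C / real k) sequentially"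
          using elim(1) by (auto intro!: eventually_mono[OF eventually_ge_at_top[of N]])
        show "(\<lambda>k. C / real k) \<longlonglongrightarrow> 0"
          by (rule lim_const_over_n)
      qed
      moreover have "(\<lambda>k. u t x - w k x) \<longlonglongrightarrow> u t x - v x"
        by (intro tendsto_intros lim elim)
      ultimately show ?case
        using LIMSEQ_unique by fastforce
    qed
    show "\<bar>v x - U x\<bar> \<le> exp (- m * t)" if "x \<in> - {- l, l}" for x
    proof (rule LIMSEQ_le_const2)
      show "(\<lambda>k. \<bar>w k x - U x\<bar>) \<longlonglongrightarrow> \<bar>v x - U x\<bar>"
        using that by (intro tendsto_intros lim) (simp add: S_def)
      have "\<bar>w k x - U x\<bar> \<le> exp (- m * t)" if "N \<le> k" for k
      proof -
        have "\<bar>w k x - U x\<bar> \<le> (1 - t / real k * m) ^ k"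
          unfolding w_def by (rule euler_iterate_near_equilibrium[OF small[OF that] U initial_window])
        also have "\<dots> \<le> exp (- (t / real k * m)) ^ k"
        proof (rule power_mono)
          show "1 - t / real k * m \<le> exp (- (t / real k * m))"
            using exp_ge_add_one_self[of "- (t / real k * m)"] by simp
          \<comment> \<open>Raising the inequality to a power requires a nonnegative base, which is
            where the smallness of the step is used.\<close>
          have "t / real k * (d + m) \<le> 1" "0 \<le> t / real k * d"
            using small[OF that] d_pos t by (simp_all add: small_step_def)
          then show "0 \<le> 1 - t / real k * m"
            by (simp only: distrib_left)
        qed
        also have "\<dots> = exp (- m * t)"
          using that N by (simp flip: exp_of_nat_mult)
        finally show ?thesis .
      qed
      then show "\<exists>N. \<forall>n\<ge>N. \<bar>w n x - U x\<bar> \<le> exp (- m * t)"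
        by blast
    qed
  qed
qed

text \<open>The representative is chosen separately at each time. It satisfies a two-sided estimate
  with rate \<open>exp (- m * t)\<close>, uniform in \<open>x\<close>, whose lower half is the
  claim.\<close>

lemma cauchy_solution_lower_bound:
  assumes u: "cauchy_solution laplace_kernel d f (indicator {- l..l}) u"
    and U: "U \<in> window" "\<And>x. rhs U x = 0"
  obtains v where "continuous_representative_on (- {- l, l}) u v" "le_liminf_uniformly_on (- {- l, l}) U v"
proof -
  define P where "P t v \<longleftrightarrow> (AE x in lborel. v x = u t x) \<and> continuous_on (- {- l, l}) v \<and>
      (\<forall>x\<in>- {- l, l}. \<bar>v x - U x\<bar> \<le> exp (- m * t))" for t v
  have "\<exists>v. P t v" if "t \<ge> 0" for t
    unfolding P_def by (rule euler_limit[OF u that U]) blast+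
  then obtain v where "\<And>t. t \<ge> 0 \<Longrightarrow> P t (v t)"
    by metis
  then have v: "\<And>t. t \<ge> 0 \<Longrightarrow> AE x in lborel. v t x = u t x"
    "\<And>t. t \<ge> 0 \<Longrightarrow> continuous_on (- {- l, l}) (v t)"
    "\<And>t x. t \<ge> 0 \<Longrightarrow> x \<in> - {- l, l} \<Longrightarrow> \<bar>v t x - U x\<bar> \<le> exp (- m * t)"
    by (simp_all add: P_def)
  show thesis
  proof (rule that)
    show "continuous_representative_on (- {- l, l}) u v"
      using v by (auto simp: continuous_representative_on_def)
    show "le_liminf_uniformly_on (- {- l, l}) U v"
      unfolding le_liminf_uniformly_on_def
    proof (intro allI impI)
      fix e :: real assume "e > 0"
      have "((\<lambda>t. exp (- m * t)) \<longlongrightarrow> 0) at_top"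
        by (rule filterlim_compose[OF exp_at_bot]
            filterlim_tendsto_neg_mult_at_bot[OF tendsto_const _ filterlim_ident])+ (use m_pos in simp)
      then have "eventually (\<lambda>t. exp (- m * t) < e) at_top"
        using \<open>e > 0\<close> by (rule order_tendstoD)
      then obtain T where T: "\<And>t. t \<ge> T \<Longrightarrow> exp (- m * t) < e"
        by (auto simp: eventually_at_top_linorder)
      have "v t x \<ge> U x - e" if "t \<ge> max 1 T" "x \<in> - {- l, l}" for t x
        using v(3)[of t x] T[of t] that by auto
      then show "\<exists>T>0. \<forall>t\<ge>T. \<forall>x\<in>- {- l, l}. v t x \<ge> U x - e"
        by (intro exI[of _ "max 1 T"]) auto
    qed
  qed
qed

end

section \<open>The ground state below the limit\<close>

lemma decrease_of_deriv_le:
  fixes f f' :: "real \<Rightarrow> real"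
  assumes der: "\<And>x. (f has_real_derivative f' x) (at x)" and le: "\<And>x. x \<in> {a..b} \<Longrightarrow> f' x \<le> c"
    and uv: "a \<le> u" "u \<le> v" "v \<le> b"
  shows "f v - f u \<le> c * (v - u)"
proof (cases "u = v")
  case False
  then obtain z where z: "u < z" "z < v" "f v - f u = (v - u) * f' z"
    using MVT2[of u v f f'] der uv by auto
  have "(v - u) * f' z \<le> (v - u) * c"
    using z uv by (intro mult_left_mono le) auto
  then show ?thesis
    using z by (simp add: mult.commute)
qed simp

lemma C1_lipschitz_on_ball:
  fixes f f' :: "real \<Rightarrow> real"
  assumes der: "\<And>x. (f has_real_derivative f' x) (at x)" and cont: "continuous_on UNIV f'"
  shows "\<exists>L>0. \<forall>u v. \<bar>u\<bar> \<le> M \<longrightarrow> \<bar>v\<bar> \<le> M \<longrightarrow> \<bar>f u - f v\<bar> \<le> L * \<bar>u - v\<bar>"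
proof -
  have "bounded (f' ` {- M..M})"
    by (intro compact_imp_bounded compact_continuous_image continuous_on_subset[OF cont]) auto
  then obtain L where L: "L > 0" "\<And>x. x \<in> {- M..M} \<Longrightarrow> norm (f' x) \<le> L"
    unfolding bounded_pos by blast
  have "\<bar>f u - f v\<bar> \<le> L * \<bar>u - v\<bar>" if "\<bar>u\<bar> \<le> M" "\<bar>v\<bar> \<le> M" for u v
    using field_differentiable_bound[of "{- M..M}" f f' L u v] L(2) that
      has_field_derivative_at_within[OF der] by (auto simp: abs_le_iff minus_le_iff)
  then show ?thesis
    using L(1) by blast
qed

theorem proposition4p1:
  fixes K f g :: "real \<Rightarrow> real" and d a \<beta> \<gamma> up :: real
  assumes K: "\<And>x. K x = exp (- \<bar>x\<bar>) / 2"
    and d: "d > 0"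
    and f_smooth: "smooth f"
    and a: "a \<in> {0<..<1}"
    and f_zeros: "f 0 = 0" "f a = 0" "f 1 = 0"
    and f_neg: "\<And>u. u \<in> {0<..<a} \<Longrightarrow> f u < 0"
    and f_pos: "\<And>u. u \<in> {a<..<1} \<Longrightarrow> f u > 0"
    and f_deriv: "deriv f 0 < 0" "deriv f 1 < 0" "deriv f a > 0"
    and f_integral: "integral {0..1} f > 0"
    and g: "\<And>u. g u = u - f u / d"
    and \<beta>\<gamma>: "0 < \<beta>" "\<beta> < \<gamma>" "\<gamma> < 1"
    and g_deriv_pos: "\<And>u. u \<in> {0..<\<beta>} \<union> {\<gamma><..1} \<Longrightarrow> deriv g u > 0"
    and g_deriv_neg: "\<And>u. u \<in> {\<beta><..<\<gamma>} \<Longrightarrow> deriv g u < 0"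
    and g_deriv_zero: "deriv g \<beta> = 0" "deriv g \<gamma> = 0"
    and up: "up \<in> {\<gamma><..<1}" "deriv f up = 0"
    and f_deriv_neg: "\<And>u. u \<in> {up<..1} \<Longrightarrow> deriv f u < 0"
    and g_up: "g up < 0"
  shows "\<exists>l0>0. \<forall>l\<in>{0<..<l0}. \<exists>U.
           ground_state K d f U \<and>
           {x. \<not> isCont U x} = {- l, l} \<and>
           (\<forall>u. cauchy_solution K d f (indicator {- l..l}) u \<longrightarrow>
              (\<exists>v. continuous_representative_on (- {- l, l}) u v \<and>
                   le_liminf_uniformly_on (- {- l, l}) U v))"
proof -
  have K_eq: "K = laplace_kernel"
    using K by (auto simp: laplace_kernel_def)
  have der: "(f has_real_derivative deriv f x) (at x)" for x
    using f_smooth[unfolded smooth_def, rule_format, of 0 x] by (simp add: DERIV_deriv_iff_field_differentiable)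
  have "deriv f field_differentiable at x" for x
    using f_smooth[unfolded smooth_def, rule_format, of 1 x] by simp
  then have deriv_cont: "isCont (deriv f) x" for x
    by (rule field_differentiable_imp_continuous_at)
  then have deriv_cont_on: "continuous_on A (deriv f)" for A
    by (intro continuous_at_imp_continuous_on) auto
  have "continuous_on {up..1} f"
    using der by (intro continuous_at_imp_continuous_on ballI DERIV_isCont)
  then have "continuous_on {up..1} g"
    unfolding g[abs_def] using d by (intro continuous_intros) auto
  \<comment> \<open>The intermediate value theorem applies since \<open>g up < 0\<close> and
    \<open>g 1 = 1\<close>. The zero of \<open>g\<close> is where
    \<open>f \<rho> = d * \<rho>\<close>, which is the inner barrier.\<close>
  then obtain \<rho> where \<rho>: "up \<le> \<rho>" "\<rho> \<le> 1" "g \<rho> = 0"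
    using IVT'[of g up 0 1] g_up up(1) f_zeros(3) by (auto simp: g)
  have \<rho>': "up < \<rho>" "\<rho> < 1"
    using \<rho> g_up f_zeros(3) g[of 1] by (auto simp: less_le)
  have "\<rho> > 0"
    using \<rho>' up(1) \<beta>\<gamma> by auto
  \<comment> \<open>The negative derivative on \<open>[\<rho>, 1]\<close> is bounded away from 0,
    since its maximum is attained there and \<open>\<rho>\<close> exceeds \<open>up\<close>.\<close>
  obtain z where z: "z \<in> {\<rho>..1}" "\<And>x. x \<in> {\<rho>..1} \<Longrightarrow> deriv f x \<le> deriv f z"
    using continuous_attains_sup[OF compact_Icc _ deriv_cont_on, of \<rho> 1] \<rho>' by auto
  have "deriv f z < 0"
    using z(1) \<rho>' by (intro f_deriv_neg) auto
  have "eventually (\<lambda>x. deriv f x < deriv f 0 / 2) (at 0)"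
    using deriv_cont[of 0] f_deriv(1) unfolding isCont_def by (intro order_tendstoD) auto
  then obtain r where r: "r > 0" "\<And>x. x \<noteq> 0 \<Longrightarrow> \<bar>x\<bar> < r \<Longrightarrow> deriv f x < deriv f 0 / 2"
    by (auto simp: eventually_at dist_real_def)
  \<comment> \<open>Half of \<open>r\<close> stays inside the neighbourhood where \<open>f'\<close>
    is below half of \<open>f' 0\<close>; half of \<open>\<rho>\<close> leaves a gap between the two
    bands.\<close>
  define \<delta> where "\<delta> = min (r / 2) (\<rho> / 2)"
  define m where "m = min (- deriv f z) (- deriv f 0 / 2)"
  have \<delta>: "0 < \<delta>" "\<delta> < \<rho>" "\<delta> < r"
    using r(1) \<open>\<rho> > 0\<close> by (auto simp: \<delta>_def)
  have m: "m > 0"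
    using \<open>deriv f z < 0\<close> f_deriv(1) by (auto simp: m_def)
  \<comment> \<open>The neighbourhood is punctured; at 0 itself \<open>f' 0 < f' 0 / 2\<close>
    because \<open>f' 0\<close> is negative.\<close>
  have low: "deriv f x \<le> - m" if "x \<in> {0..\<delta>}" for x
    using r(2)[of x] that \<delta> f_deriv(1) by (cases "x = 0") (auto simp: m_def)
  have high: "deriv f x \<le> - m" if "x \<in> {\<rho>..1}" for x
    using z(2)[OF that] by (auto simp: m_def)
  have f\<delta>: "f \<delta> \<le> - m * \<delta>"
    using decrease_of_deriv_le[OF der low, where u = 0 and v = \<delta>] f_zeros(1) \<delta>(1) by simp
  show ?thesis
  \<comment> \<open>Since \<open>f \<delta> \<le> - m * \<delta>\<close>, this threshold is what
    \<open>f \<delta> + d * l \<le> 0\<close> asks of \<open>l\<close>.\<close>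
  proof (intro exI[of _ "m * \<delta> / d"] conjI ballI)
    show "m * \<delta> / d > 0"
      using m \<delta> d by simp
    fix l assume l: "l \<in> {0<..<m * \<delta> / d}"
    then have "d * l \<le> m * \<delta>"
      using d by (simp add: field_simps)
    interpret stable_window f d m \<delta> \<rho> l
    proof
      show "f v - f u \<le> - m * (v - u)" if "0 \<le> u" "u \<le> v" "v \<le> \<delta>" for u v
        by (rule decrease_of_deriv_le[OF der low that])
      show "f v - f u \<le> - m * (v - u)" if "\<rho> \<le> u" "u \<le> v" "v \<le> 1" for u v
        by (rule decrease_of_deriv_le[OF der high that])
      show "d * \<rho> \<le> f \<rho>"
        using \<rho>(3) d by (simp add: g field_simps)
      show "f \<delta> + d * l \<le> 0"
        using f\<delta> \<open>d * l \<le> m * \<delta>\<close> by simp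
    qed (use d m l \<delta> \<rho>' f_zeros C1_lipschitz_on_ball[OF der deriv_cont_on] in auto)
    \<comment> \<open>\<open>U\<close> is fixed before any solution is considered, so one ground
      state serves every solution with this datum.\<close>
    obtain U where U: "U \<in> window" "\<And>x. rhs U x = 0" "\<And>x. U (- x) = U x"
      "\<And>x. U x \<le> exp (m / (d + m) * (l - \<bar>x\<bar>))"
      using window_equilibrium_exists by blast
    have "\<exists>v. continuous_representative_on (- {- l, l}) u v \<and> le_liminf_uniformly_on (- {- l, l}) U v"
      if "cauchy_solution laplace_kernel d f (indicator {- l..l}) u" for u
      by (rule cauchy_solution_lower_bound[OF that U(1,2)]) (intro exI conjI)
    then show "\<exists>U. ground_state K d f U \<and> {x. \<not> isCont U x} = {- l, l} \<and>
           (\<forall>u. cauchy_solution K d f (indicator {- l..l}) u \<longrightarrow>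
              (\<exists>v. continuous_representative_on (- {- l, l}) u v \<and>
                   le_liminf_uniformly_on (- {- l, l}) U v))"
      unfolding K_eq
      using window_equilibrium_ground_state[OF U] window_equilibrium_discontinuities[OF U(1,2)]
      by (intro exI[of _ U] conjI allI impI)
  qed
qed

end
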